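(* Consider the semi-discrete flux-differencing discontinuous Galerkin scheme (DG) described in the context on a mesh $\mathcal T$ with periodic boundary conditions, with volume numerical flux $\bm{\mathcal D}_j$ and surface numerical flux $\bm{\mathcal D}^*_j$, $j=1,\dots,d$. Suppose that $\bm{\mathcal D}_j$ satisfies the conservative entropy shuffle relation: for all states $\bm p,\bm q$, points $\bm y,\bm x$ and $j=1,\dots,d$, $$\bm\beta^T(\bm p,\bm y)\bm{\mathcal D}_j(\bm p,\bm y,\bm q,\bm x)-\bm\beta^T(\bm q,\bm x)\bm{\mathcal D}_j(\bm q,\bm x,\bm p,\bm y)=\zeta_j(\bm q,\bm x)-\zeta_j(\bm p,\bm y),$$ that $\bm{\mathcal D}^*_j$ satisfies the dissipative entropy shuffle relation: for all states $\bm p,\bm q$ on the two sides of a face, $$\sum_{i=1}^d n_i\left(\bm\beta^T(\bm p,\bm y)\bm{\mathcal D}^*_i(\bm p,\bm y,\bm q,\bm x)-\bm\beta^T(\bm q,\bm x)\bm{\mathcal D}^*_i(\bm q,\bm x,\bm p,\bm y)\right)\le\sum_{i=1}^d n_i\left(\zeta_i(\bm q,\bm x)-\zeta_i(\bm p,\bm y)\right),$$ where $\bm n$ is the unit normal at the face point pointing outward from the element on the $(\bm q,\bm x)$ side, and that the fluxes (and the source) in the scheme are evaluated with the entropy-projected solution $\tilde{\bm q}$. Then every solution of the scheme satisfies $$\sum_{K\in\mathcal T}\bm 1^T\bm J^{v,K}\bm W^{v,K}\frac{d\eta(\bm q^{v,K})}{dt}\le\sum_{K\in\mathcal T}\bm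 1^T\bm J^{v,K}\bm W^{v,K}\,\Pi(\tilde{\bm q}^{v,K},\bm x^{v,K}),$$ where the superscript $K$ denotes the quantities belonging to element $K$.
   Context: Balance law and entropy. The balance law is $\partial_t\bm q+\sum_{i=1}^d\bm A_i(\bm q,\bm x)\partial_{x_i}\bm h_i(\bm q,\bm x)=\bm g(\bm q,\bm x)$, with $\bm q\in\mathbb{R}^{N_c}$, $\bm h_i\in\mathbb{R}^{N_d}$, $\bm A_i\in\mathbb{R}^{N_c\times N_d}$, $\bm g\in\mathbb{R}^{N_c}$. It has a convex scalar entropy $\eta(\bm q,\bm x)$, entropy fluxes $\zeta_j(\bm q,\bm x)$ and entropy variables $\bm\beta=\partial\eta/\partial\bm q$ (components $\beta_\alpha=\partial\eta/\partial q_\alpha$), with $\partial\zeta_j/\partial q_\alpha=\bm\beta^T\bm A_j\,\partial\bm h_j/\partial q_\alpha$. It is assumed throughout that the entropy production is $\Pi(\bm q,\bm x)=\bm\beta(\bm q,\bm x)^T\bm g(\bm q,\bm x)$ (equivalently $\sum_i(\partial_{x_i}\zeta_i-\bm\beta^T\bm A_i\partial_{x_i}\bm h_i)=0$) and that for each $\bm x$ the map $\bm q\mapsto\bm\beta(\bm q,\bm x)$ is invertible, with inverse $\beta^{-1}(\cdot,\bm x)$. Fluxes. The volume flux has the form $\bm{\mathcal D}_i(\bm p,\bm y,\bm q,\bm x)=\bm{\mathcal A}_i(\bm p,\bm y,\bm q,\bm x)\bm{\mathcal H}_i(\bm p,\bm y,\bm q,\bm x)+\bm{\mathcal A}_i(\bm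 q,\bm x,\bm p,\bm y)\bm{\mathcal H}_i(\bm q,\bm x,\bm p,\bm y)-(\bm{\mathcal A}_i(\bm p,\bm y,\bm q,\bm x)+\bm{\mathcal A}_i(\bm q,\bm x,\bm p,\bm y))\bm h_i(\bm p,\bm y)$, with $2\bm{\mathcal A}_i(\bm q,\bm x,\bm q,\bm x)=\bm A_i(\bm q,\bm x)$ and $\bm{\mathcal H}_i(\bm q,\bm x,\bm q,\bm x)=\bm h_i(\bm q,\bm x)$. The surface flux $\bm{\mathcal D}^*_i(\bm p,\bm y,\bm q,\bm x)\in\mathbb{R}^{N_c}$ may differ from it (and may also depend on the unit normal of the face oriented outward from the element supplying its first argument; this dependence is suppressed). Mesh. $\mathcal T$ is the finite set of disjoint elements tessellating the domain; with periodic boundary conditions every face is shared by exactly two elements (after periodic identification), and the surface quadrature nodes of the two elements sharing a face are matched pointwise. All of the following is defined for each element $K\in\mathcal T$ (superscript $K$ suppressed). Reference element operators. $K$ is the image of a reference element $\hat K$ under a smooth transformation, with reference coordinates $\bm\xi$. $\{\upsilon_m\}_{m=1}^{N_p}$ is a basis of a polynomial space on $\hat K$ (degree $N$). Volume and surface quadratures on $\hat K$ have nodes $\bm\xi^v,\bm\xi^f$, weights $\bm w^v,\bm w^f$ (surface weights positive) and $N_q^v,N_q^f$ points; $\bm W^v=\mathrm{diag}(\bm w^v)$, $\bm W^f=\mathrm{diag}(\bm w^f)$; $\bm J^v$ is the diagonal matrix of the volume Jacobian determinant $J^v$ at the volume nodes. $[\bm V^v]_{nm}=\upsilon_m([\bm\xi^v]_n)$,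 $[\bm V^f]_{nm}=\upsilon_m([\bm\xi^f]_n)$, $\bm V=\begin{bmatrix}\bm V^v\\ \bm V^f\end{bmatrix}$. $\bm M^v=(\bm V^v)^T\bm W^v\bm J^v\bm V^v$ (invertible), $\bm P^v=(\bm M^v)^{-1}(\bm V^v)^T\bm J^v\bm W^v$. $\bm D^N_i$ is the matrix mapping the expansion coefficients of a polynomial to those of its $\xi_i$-derivative; $\bm Q^v_i=\bm W^v\bm V^v\bm D^N_i\bm P^v$; $\bm E^v=\bm V^f\bm P^v$; $\bm B^f_i=\bm W^f\hat{\bm N}^f_i\hat{\bm J}^f$ with $\hat{\bm N}^f_i,\hat{\bm J}^f$ diagonal matrices of the $i$-th component of the reference outward unit normal and of the reference-face Jacobian determinant at the surface nodes. The skew-hybridized SBP operator is $$\bm Q_i=\frac12\begin{bmatrix}\bm Q^v_i-(\bm Q^v_i)^T&(\bm E^v)^T\bm B^f_i\\-\bm B^f_i\bm E^v&\bm B^f_i\end{bmatrix},$$ and it is assumed that $\bm Q_i\bm 1=\bm 0$. The metric matrices $\bm G_{jk}=\mathrm{diag}(\bm G^v_{jk},\bm G^f_{jk})$ are diagonal, containing (approximations of) $J^v\,\partial\xi_k/\partial x_j$ at volume and surface nodes, and satisfy the discrete geometric conservation law $\sum_{k=1}^d\bm Q_k\bm G_{jk}\bm 1=\bm 0$ for each $j$. At the surface nodes $\sum_k\bm G^f_{jk}\bm B^f_k=\bm W^f\,\mathrm{diag}(J^fn_j)$ with $J^f>0$ the surface Jacobian and $\bm n$ the outward unit normal of $K$;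 with superscripts $-$ and $+$ for the matrices of $K$ and of its neighbours at matched surface nodes, $\sum_k\bm G^{-f}_{jk}\bm B^{-f}_k=-\sum_k\bm G^{+f}_{jk}\bm B^{+f}_k$. Entropy projection. For expansion coefficients $\bm q^N_\alpha$, $\alpha=1,\dots,N_c$, set $\bm q^v_\alpha=\bm V^v\bm q^N_\alpha$; $\bm x^v,\bm x^f,\bm x$ are the node coordinates (volume, surface, combined). Set $\bm\beta^N_\alpha=\bm P^v\beta_\alpha(\bm q^v,\bm x^v)$, $\bm\beta^v_\alpha=\bm V^v\bm\beta^N_\alpha$, $\bm\beta^f_\alpha=\bm V^f\bm\beta^N_\alpha$, $\bm\beta_\alpha=\bm V\bm\beta^N_\alpha$, and, pointwise, $\tilde{\bm q}^v=\beta^{-1}(\bm\beta^v,\bm x^v)$, $\tilde{\bm q}^f=\beta^{-1}(\bm\beta^f,\bm x^f)$, $\tilde{\bm q}=\beta^{-1}(\bm\beta,\bm x)$. Scheme (DG). On each element, for $\alpha=1,\dots,N_c$, $$\bm M^v\frac{d\bm q^N_\alpha}{dt}+\bm V^T\sum_{j,k=1}^d\left(\bm G_{jk}(\bm Q_k\circ\bm{\mathcal D}_{j\alpha})-(\bm{\mathcal D}_{j\alpha}\circ\bm Q_k^T)\bm G_{jk}\right)\bm 1=(\bm V^v)^T\bm J^v\bm W^v\bm g^v_\alpha-\sum_{j,k=1}^d(\bm V^f)^T\bm G^f_{jk}\bm B^f_k\bm{\mathcal D}^*_{j\alpha},$$ where $\circ$ is the entrywise product, $[\bm{\mathcal D}_{j\alpha}]_{nm}=[\bm{\mathcal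 D}_j(\tilde{\bm q}_n,\bm x_n,\tilde{\bm q}_m,\bm x_m)]_\alpha$, $[\bm g^v_\alpha]_n=[\bm g(\tilde{\bm q}^v_n,\bm x^v_n)]_\alpha$ and $[\bm{\mathcal D}^*_{j\alpha}]_n=[\bm{\mathcal D}^*_j(\tilde{\bm q}^{-f}_n,\bm x^{-f}_n,\tilde{\bm q}^{+f}_n,\bm x^{+f}_n)]_\alpha$, with superscripts $-f$ and $+f$ denoting the values at the surface nodes taken from inside the element and from the neighbouring element, respectively. $\eta(\bm q^v)$ is the vector of values $\eta(\bm q^v_n,\bm x^v_n)$, $\Pi(\tilde{\bm q}^v,\bm x^v)$ the vector of values $\Pi(\tilde{\bm q}^v_n,\bm x^v_n)$, and $\bm 1$ is the vector of ones. Time is continuous (exact integration in time). *)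

theory Defs
  imports
    "HOL-Analysis.Analysis"
    "Jordan_Normal_Form.Gauss_Jordan_Elimination"
begin

text \<open>
  States, points and fluxes live in \<open>real ^ 'n\<close>; the discretization matrices, whose sizes may
  differ from element to element, are Jordan_Normal_Form matrices.  The names \<open>vec\<close> and \<open>mat\<close> and
  the infix \<open>$\<close> are reserved for the latter, components of \<open>real ^ 'n\<close> are written \<open>x $h i\<close>.
\<close>

hide_const (open) Finite_Cartesian_Product.vec Finite_Cartesian_Product.mat
hide_type (open) Finite_Cartesian_Product.vec
no_notation vec_nth (infixl \<open>$\<close> 90)
notation vec_nth (infixl \<open>$h\<close> 90)

text \<open>
  \<open>S\<close> is the set of admissible states and \<open>X\<close> the spatial domain.  If \<open>S\<close> is not the whole space,
  the inverse of \<open>\<lambda>q. \<beta> q x\<close> is defined on the image of \<open>S\<close> only.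
\<close>

definition entropy_balance_law ::
  "(real^'c) set \<Rightarrow> (real^'d) set \<Rightarrow>
   ('d \<Rightarrow> real^'c \<Rightarrow> real^'d \<Rightarrow> real^'e^'c) \<Rightarrow> ('d \<Rightarrow> real^'c \<Rightarrow> real^'d \<Rightarrow> real^'e) \<Rightarrow>
   (real^'c \<Rightarrow> real^'d \<Rightarrow> real^'c) \<Rightarrow> (real^'c \<Rightarrow> real^'d \<Rightarrow> real) \<Rightarrow>
   ('d \<Rightarrow> real^'c \<Rightarrow> real^'d \<Rightarrow> real) \<Rightarrow> (real^'c \<Rightarrow> real^'d \<Rightarrow> real^'c) \<Rightarrow>
   (real^'c \<Rightarrow> real^'d \<Rightarrow> real) \<Rightarrow> bool" where
  "entropy_balance_law S X A h g \<eta> \<zeta> \<beta> EP \<longleftrightarrow>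
     open S \<and> convex S \<and>
     (\<forall>x\<in>X. convex_on S (\<lambda>q. \<eta> q x)) \<and>
     (\<forall>x\<in>X. \<forall>q\<in>S. GDERIV (\<lambda>q. \<eta> q x) q :> \<beta> q x) \<and>
     (\<forall>j. \<forall>x\<in>X. \<forall>q\<in>S. (\<lambda>q. h j q x) differentiable (at q) \<and> (\<lambda>q. \<zeta> j q x) differentiable (at q)) \<and>
     (\<forall>j \<alpha>. \<forall>x\<in>X. \<forall>q\<in>S.
        frechet_derivative (\<lambda>q. \<zeta> j q x) (at q) (axis \<alpha> 1) =
        inner (\<beta> q x) (A j q x *v frechet_derivative (\<lambda>q. h j q x) (at q) (axis \<alpha> 1))) \<and>
     (\<forall>x\<in>X. \<forall>q\<in>S. EP q x = inner (\<beta> q x) (g q x)) \<and>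
     (\<forall>x\<in>X. inj_on (\<lambda>q. \<beta> q x) S)"

definition volume_flux ::
  "('d \<Rightarrow> real^'c \<Rightarrow> real^'d \<Rightarrow> real^'c \<Rightarrow> real^'d \<Rightarrow> real^'e^'c) \<Rightarrow>
   ('d \<Rightarrow> real^'c \<Rightarrow> real^'d \<Rightarrow> real^'c \<Rightarrow> real^'d \<Rightarrow> real^'e) \<Rightarrow>
   ('d \<Rightarrow> real^'c \<Rightarrow> real^'d \<Rightarrow> real^'e) \<Rightarrow>
   'd \<Rightarrow> real^'c \<Rightarrow> real^'d \<Rightarrow> real^'c \<Rightarrow> real^'d \<Rightarrow> real^'c" where
  "volume_flux \<A> \<H> h i p y q x =
     \<A> i p y q x *v \<H> i p y q x + \<A> i q x p y *v \<H> i q x p y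
     - (\<A> i p y q x + \<A> i q x p y) *v h i p y"

definition consistent_flux ::
  "(real^'c) set \<Rightarrow> (real^'d) set \<Rightarrow>
   ('d \<Rightarrow> real^'c \<Rightarrow> real^'d \<Rightarrow> real^'e^'c) \<Rightarrow> ('d \<Rightarrow> real^'c \<Rightarrow> real^'d \<Rightarrow> real^'e) \<Rightarrow>
   ('d \<Rightarrow> real^'c \<Rightarrow> real^'d \<Rightarrow> real^'c \<Rightarrow> real^'d \<Rightarrow> real^'e^'c) \<Rightarrow>
   ('d \<Rightarrow> real^'c \<Rightarrow> real^'d \<Rightarrow> real^'c \<Rightarrow> real^'d \<Rightarrow> real^'e) \<Rightarrow> bool" where
  "consistent_flux S X A h \<A> \<H> \<longleftrightarrow>
     (\<forall>i. \<forall>q\<in>S. \<forall>x\<in>X. 2 *\<^sub>R \<A> i q x q x = A i q x \<and> \<H> i q x q x = h i q x)"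

definition conservative_entropy_shuffle ::
  "(real^'c) set \<Rightarrow> (real^'d) set \<Rightarrow> (real^'c \<Rightarrow> real^'d \<Rightarrow> real^'c) \<Rightarrow>
   ('d \<Rightarrow> real^'c \<Rightarrow> real^'d \<Rightarrow> real) \<Rightarrow>
   ('d \<Rightarrow> real^'c \<Rightarrow> real^'d \<Rightarrow> real^'c \<Rightarrow> real^'d \<Rightarrow> real^'c) \<Rightarrow> bool" where
  "conservative_entropy_shuffle S X \<beta> \<zeta> D \<longleftrightarrow>
     (\<forall>j. \<forall>p\<in>S. \<forall>q\<in>S. \<forall>y\<in>X. \<forall>x\<in>X.
        inner (\<beta> p y) (D j p y q x) - inner (\<beta> q x) (D j q x p y) = \<zeta> j q x - \<zeta> j p y)"

definition ones :: "nat \<Rightarrow> real vec" where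
  "ones n = vec n (\<lambda>_. 1)"

definition sum_vec :: "nat \<Rightarrow> ('d::finite \<Rightarrow> real vec) \<Rightarrow> real vec" where
  "sum_vec n v = vec n (\<lambda>m. \<Sum>k\<in>UNIV. v k $ m)"

definition sum_mat :: "nat \<Rightarrow> nat \<Rightarrow> ('d::finite \<Rightarrow> real mat) \<Rightarrow> real mat" where
  "sum_mat nr nc M = mat nr nc (\<lambda>(n, m). \<Sum>k\<in>UNIV. M k $$ (n, m))"

definition hadamard :: "real mat \<Rightarrow> real mat \<Rightarrow> real mat" (infixl \<open>\<circ>\<^sub>h\<close> 70) where
  "A \<circ>\<^sub>h B = mat (dim_row A) (dim_col A) (\<lambda>(n, m). A $$ (n, m) * B $$ (n, m))"

text \<open>
  \<open>deriv_mat i\<close> is $D^N_i$, \<open>ref_normal\<close> and \<open>ref_face_jac\<close> are the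
  entries of $\hat N^f$ and $\hat J^f$, \<open>met_v j k\<close> and \<open>met_f j k\<close> the diagonals of $G^v_{jk}$ and
  $G^f_{jk}$, and \<open>node_face i\<close> is a label for the face of \<open>K\<close> to which the surface node \<open>i\<close> belongs.
\<close>

record ('d::finite) dg_element =
  ref_elem :: "(real^'d) set"
  trafo :: "real^'d \<Rightarrow> real^'d"
  poly_deg :: nat
  np :: nat
  nqv :: nat
  nqf :: nat
  shape :: "nat \<Rightarrow> real^'d \<Rightarrow> real"
  node_v :: "nat \<Rightarrow> real^'d"
  node_f :: "nat \<Rightarrow> real^'d"
  weight_v :: "nat \<Rightarrow> real"
  weight_f :: "nat \<Rightarrow> real"
  deriv_mat :: "'d \<Rightarrow> real mat"
  ref_normal :: "nat \<Rightarrow> real^'d"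
  ref_face_jac :: "nat \<Rightarrow> real"
  met_v :: "'d \<Rightarrow> 'd \<Rightarrow> nat \<Rightarrow> real"
  met_f :: "'d \<Rightarrow> 'd \<Rightarrow> nat \<Rightarrow> real"
  out_normal :: "nat \<Rightarrow> real^'d"
  face_jac :: "nat \<Rightarrow> real"
  node_face :: "nat \<Rightarrow> nat"

definition phys_elem :: "('d::finite) dg_element \<Rightarrow> (real^'d) set" where
  "phys_elem K = trafo K ` ref_elem K"

definition xv :: "('d::finite) dg_element \<Rightarrow> nat \<Rightarrow> real^'d" where
  "xv K n = trafo K (node_v K n)"

definition xf :: "('d::finite) dg_element \<Rightarrow> nat \<Rightarrow> real^'d" where
  "xf K n = trafo K (node_f K n)"

definition xc :: "('d::finite) dg_element \<Rightarrow> nat \<Rightarrow> real^'d" where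
  "xc K n = (if n < nqv K then xv K n else xf K (n - nqv K))"

definition vol_jac :: "('d::finite) dg_element \<Rightarrow> real^'d \<Rightarrow> real" where
  "vol_jac K \<xi> = Determinants.det (matrix (frechet_derivative (trafo K) (at \<xi>)))"

definition Wv :: "('d::finite) dg_element \<Rightarrow> real mat" where
  "Wv K = mat_diag (nqv K) (weight_v K)"

definition Wf :: "('d::finite) dg_element \<Rightarrow> real mat" where
  "Wf K = mat_diag (nqf K) (weight_f K)"

definition Jv :: "('d::finite) dg_element \<Rightarrow> real mat" where
  "Jv K = mat_diag (nqv K) (\<lambda>n. vol_jac K (node_v K n))"

definition Vv :: "('d::finite) dg_element \<Rightarrow> real mat" where
  "Vv K = mat (nqv K) (np K) (\<lambda>(n, m). shape K m (node_v K n))"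

definition Vf :: "('d::finite) dg_element \<Rightarrow> real mat" where
  "Vf K = mat (nqf K) (np K) (\<lambda>(n, m). shape K m (node_f K n))"

definition Vc :: "('d::finite) dg_element \<Rightarrow> real mat" where
  "Vc K = Vv K @\<^sub>r Vf K"

definition Mv :: "('d::finite) dg_element \<Rightarrow> real mat" where
  "Mv K = (Vv K)\<^sup>T * Wv K * Jv K * Vv K"

definition Pv :: "('d::finite) dg_element \<Rightarrow> real mat" where
  "Pv K = the (mat_inverse (Mv K)) * (Vv K)\<^sup>T * Jv K * Wv K"

definition Qv :: "('d::finite) dg_element \<Rightarrow> 'd \<Rightarrow> real mat" where
  "Qv K i = Wv K * Vv K * deriv_mat K i * Pv K"

definition Ev :: "('d::finite) dg_element \<Rightarrow> real mat" where
  "Ev K = Vf K * Pv K"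

definition Bf :: "('d::finite) dg_element \<Rightarrow> 'd \<Rightarrow> real mat" where
  "Bf K i = Wf K * mat_diag (nqf K) (\<lambda>n. ref_normal K n $h i) * mat_diag (nqf K) (ref_face_jac K)"

definition Qc :: "('d::finite) dg_element \<Rightarrow> 'd \<Rightarrow> real mat" where
  "Qc K i = (1 / 2) \<cdot>\<^sub>m four_block_mat
     (Qv K i - (Qv K i)\<^sup>T) ((Ev K)\<^sup>T * Bf K i)
     (- (Bf K i * Ev K))   (Bf K i)"

definition Gv :: "('d::finite) dg_element \<Rightarrow> 'd \<Rightarrow> 'd \<Rightarrow> real mat" where
  "Gv K j k = mat_diag (nqv K) (met_v K j k)"

definition Gf :: "('d::finite) dg_element \<Rightarrow> 'd \<Rightarrow> 'd \<Rightarrow> real mat" where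
  "Gf K j k = mat_diag (nqf K) (met_f K j k)"

definition Gc :: "('d::finite) dg_element \<Rightarrow> 'd \<Rightarrow> 'd \<Rightarrow> real mat" where
  "Gc K j k = four_block_mat
     (Gv K j k) (0\<^sub>m (nqv K) (nqf K))
     (0\<^sub>m (nqf K) (nqv K)) (Gf K j k)"

text \<open>Polynomials of degree at most \<open>N\<close> in each coordinate; this comprises both the total-degree
  and the tensor-product spaces of degree \<open>N\<close>.\<close>

definition poly_fun :: "nat \<Rightarrow> (real^'d \<Rightarrow> real) \<Rightarrow> bool" where
  "poly_fun N f \<longleftrightarrow> (\<exists>c. \<forall>\<xi>. f \<xi> =
     (\<Sum>a\<in>{a::'d \<Rightarrow> nat. \<forall>i. a i \<le> N}. c a * (\<Prod>i\<in>UNIV. (\<xi> $h i) ^ a i)))"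

definition expansion :: "('d::finite) dg_element \<Rightarrow> real vec \<Rightarrow> real^'d \<Rightarrow> real" where
  "expansion K c \<xi> = (\<Sum>m<np K. c $ m * shape K m \<xi>)"

primrec iter_partial ::
  "'d list \<Rightarrow> (real^'d \<Rightarrow> 'b::real_normed_vector) \<Rightarrow> real^'d \<Rightarrow> 'b" where
  "iter_partial [] f = f"
| "iter_partial (i # is) f = (\<lambda>x. frechet_derivative (iter_partial is f) (at x) (axis i 1))"

definition smooth_on :: "(real^'d) set \<Rightarrow> (real^'d \<Rightarrow> 'b::real_normed_vector) \<Rightarrow> bool" where
  "smooth_on S f \<longleftrightarrow>
     (\<exists>U. open U \<and> S \<subseteq> U \<and> (\<forall>is. \<forall>x\<in>U. iter_partial is f differentiable (at x)))"

text \<open>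
  Unit vector of the (Frechet) normal cone of \<open>S\<close> at \<open>x\<close>.  Where the boundary of \<open>S\<close> is smooth this
  is the outward unit normal; at a convex edge or corner the normals of all adjacent faces
  qualify, as needed for surface nodes on the boundary of a face.
\<close>

definition outward_unit_normal :: "(real^'d) set \<Rightarrow> real^'d \<Rightarrow> real^'d \<Rightarrow> bool" where
  "outward_unit_normal S x \<nu> \<longleftrightarrow> x \<in> S \<and> norm \<nu> = 1 \<and>
     (\<forall>\<epsilon>>0. \<exists>\<delta>>0. \<forall>y\<in>S. dist y x < \<delta> \<longrightarrow> inner \<nu> (y - x) \<le> \<epsilon> * dist y x)"

definition valid_element :: "('d::finite) dg_element \<Rightarrow> bool" where
  "valid_element K \<longleftrightarrow>
     compact (ref_elem K) \<and> interior (ref_elem K) \<noteq> {} \<and>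
     smooth_on (ref_elem K) (trafo K) \<and>
     (\<forall>m<np K. poly_fun (poly_deg K) (shape K m)) \<and>
     (\<forall>c\<in>carrier_vec (np K). (\<forall>\<xi>\<in>ref_elem K. expansion K c \<xi> = 0) \<longrightarrow> c = 0\<^sub>v (np K)) \<and>
     (\<forall>i. deriv_mat K i \<in> carrier_mat (np K) (np K)) \<and>
     (\<forall>i. \<forall>c\<in>carrier_vec (np K). \<forall>\<xi>.
        frechet_derivative (expansion K c) (at \<xi>) (axis i 1) = expansion K (deriv_mat K i *\<^sub>v c) \<xi>) \<and>
     (\<forall>n<nqv K. node_v K n \<in> ref_elem K) \<and>
     (\<forall>n<nqf K. node_f K n \<in> frontier (ref_elem K)) \<and>
     (\<forall>n<nqf K. weight_f K n > 0) \<and>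
     (\<forall>n<nqf K. outward_unit_normal (ref_elem K) (node_f K n) (ref_normal K n)) \<and>
     invertible_mat (Mv K) \<and>
     (\<forall>i. Qc K i *\<^sub>v ones (nqv K + nqf K) = 0\<^sub>v (nqv K + nqf K)) \<and>
     (\<forall>j. sum_vec (nqv K + nqf K) (\<lambda>k. Qc K k * Gc K j k *\<^sub>v ones (nqv K + nqf K))
          = 0\<^sub>v (nqv K + nqf K)) \<and>
     (\<forall>n<nqf K. face_jac K n > 0 \<and> outward_unit_normal (phys_elem K) (xf K n) (out_normal K n)) \<and>
     (\<forall>j. sum_mat (nqf K) (nqf K) (\<lambda>k. Gf K j k * Bf K k)
          = Wf K * mat_diag (nqf K) (\<lambda>n. face_jac K n * out_normal K n $h j))"

definition surface_nodes :: "('d::finite) dg_element set \<Rightarrow> ('d dg_element \<times> nat) set" where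
  "surface_nodes T = {(K, n). K \<in> T \<and> n < nqf K}"

text \<open>
  \<open>L\<close> is the group of translations by which points of the domain \<open>X\<close> are identified and \<open>nbr\<close> maps a
  surface node to the coincident surface node on the other side of its face.  Nodes of one face are
  mapped to nodes of one face, so \<open>nbr\<close> pairs up the faces of the elements; no face is paired with
  itself, but an element may be its own neighbour across a periodic boundary.
\<close>

definition periodic_mesh ::
  "('d::finite) dg_element set \<Rightarrow> (real^'d) set \<Rightarrow> (real^'d) set \<Rightarrow>
   ('d dg_element \<times> nat \<Rightarrow> 'd dg_element \<times> nat) \<Rightarrow> bool" where
  "periodic_mesh T X L nbr \<longleftrightarrow>
     finite T \<and> (\<forall>K\<in>T. valid_element K) \<and>
     (\<Union>K\<in>T. phys_elem K) = X \<and>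
     pairwise (\<lambda>K K'. interior (phys_elem K) \<inter> interior (phys_elem K') = {}) T \<and>
     0 \<in> L \<and> (\<forall>a\<in>L. \<forall>b\<in>L. a - b \<in> L) \<and>
     (\<forall>(K, n)\<in>surface_nodes T. \<forall>K' n'. nbr (K, n) = (K', n') \<longrightarrow>
        (K', n') \<in> surface_nodes T \<and> nbr (K', n') = (K, n) \<and>
        (K', node_face K' n') \<noteq> (K, node_face K n) \<and>
        xf K' n' - xf K n \<in> L \<and>
        (\<forall>j. sum_mat (nqf K) (nqf K) (\<lambda>k. Gf K j k * Bf K k) $$ (n, n) =
             - sum_mat (nqf K') (nqf K') (\<lambda>k. Gf K' j k * Bf K' k) $$ (n', n'))) \<and>
     (\<forall>(K, n)\<in>surface_nodes T. \<forall>m<nqf K. node_face K m = node_face K n \<longrightarrow>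
        fst (nbr (K, m)) = fst (nbr (K, n)) \<and>
        node_face (fst (nbr (K, m))) (snd (nbr (K, m))) = node_face (fst (nbr (K, n))) (snd (nbr (K, n))))"

text \<open>
  The surface flux \<open>Ds i m p y q x\<close> has the outward unit normal \<open>m\<close> of the element supplying its first
  state \<open>p\<close> as an additional argument.  Below, \<open>n\<close> is outward from the element of \<open>(q, x)\<close>, and hence
  the normal outward from the element of \<open>(p, y)\<close> is \<open>- n\<close>.
\<close>

definition dissipative_entropy_shuffle ::
  "('d::finite) dg_element set \<Rightarrow> ('d dg_element \<times> nat \<Rightarrow> 'd dg_element \<times> nat) \<Rightarrow>
   (real^'c) set \<Rightarrow> (real^'c \<Rightarrow> real^'d \<Rightarrow> real^'c) \<Rightarrow> ('d \<Rightarrow> real^'c \<Rightarrow> real^'d \<Rightarrow> real) \<Rightarrow>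
   ('d \<Rightarrow> real^'d \<Rightarrow> real^'c \<Rightarrow> real^'d \<Rightarrow> real^'c \<Rightarrow> real^'d \<Rightarrow> real^'c) \<Rightarrow> bool" where
  "dissipative_entropy_shuffle T nbr S \<beta> \<zeta> Ds \<longleftrightarrow>
     (\<forall>(K, l)\<in>surface_nodes T. \<forall>K' l'. nbr (K, l) = (K', l') \<longrightarrow>
       (\<forall>p\<in>S. \<forall>q\<in>S. let x = xf K l; y = xf K' l'; n = out_normal K l in
         (\<Sum>i\<in>UNIV. n $h i * (inner (\<beta> p y) (Ds i (- n) p y q x) - inner (\<beta> q x) (Ds i n q x p y)))
         \<le> (\<Sum>i\<in>UNIV. n $h i * (\<zeta> i q x - \<zeta> i p y))))"

text \<open>\<open>u \<alpha>\<close> is the vector of expansion coefficients of component \<open>\<alpha>\<close> on the element \<open>K\<close>.\<close>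

definition node_value :: "('c::finite \<Rightarrow> real vec) \<Rightarrow> nat \<Rightarrow> real^'c" where
  "node_value v n = (\<chi> \<alpha>. v \<alpha> $ n)"

definition qv :: "('d::finite) dg_element \<Rightarrow> ('c::finite \<Rightarrow> real vec) \<Rightarrow> nat \<Rightarrow> real^'c" where
  "qv K u = node_value (\<lambda>\<alpha>. Vv K *\<^sub>v u \<alpha>)"

definition betaN ::
  "(real^'c \<Rightarrow> real^'d \<Rightarrow> real^'c) \<Rightarrow> ('d::finite) dg_element \<Rightarrow> ('c::finite \<Rightarrow> real vec) \<Rightarrow> 'c \<Rightarrow> real vec" where
  "betaN \<beta> K u \<alpha> = Pv K *\<^sub>v vec (nqv K) (\<lambda>n. \<beta> (qv K u n) (xv K n) $h \<alpha>)"

definition beta_v ::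
  "(real^'c \<Rightarrow> real^'d \<Rightarrow> real^'c) \<Rightarrow> ('d::finite) dg_element \<Rightarrow> ('c::finite \<Rightarrow> real vec) \<Rightarrow> nat \<Rightarrow> real^'c" where
  "beta_v \<beta> K u = node_value (\<lambda>\<alpha>. Vv K *\<^sub>v betaN \<beta> K u \<alpha>)"

definition beta_f ::
  "(real^'c \<Rightarrow> real^'d \<Rightarrow> real^'c) \<Rightarrow> ('d::finite) dg_element \<Rightarrow> ('c::finite \<Rightarrow> real vec) \<Rightarrow> nat \<Rightarrow> real^'c" where
  "beta_f \<beta> K u = node_value (\<lambda>\<alpha>. Vf K *\<^sub>v betaN \<beta> K u \<alpha>)"

definition beta_c ::
  "(real^'c \<Rightarrow> real^'d \<Rightarrow> real^'c) \<Rightarrow> ('d::finite) dg_element \<Rightarrow> ('c::finite \<Rightarrow> real vec) \<Rightarrow> nat \<Rightarrow> real^'c" where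
  "beta_c \<beta> K u = node_value (\<lambda>\<alpha>. Vc K *\<^sub>v betaN \<beta> K u \<alpha>)"

definition beta_inv ::
  "(real^'c) set \<Rightarrow> (real^'c \<Rightarrow> real^'d \<Rightarrow> real^'c) \<Rightarrow> real^'c \<Rightarrow> real^'d \<Rightarrow> real^'c" where
  "beta_inv S \<beta> b x = inv_into S (\<lambda>q. \<beta> q x) b"

definition qtilde_v ::
  "(real^'c) set \<Rightarrow> (real^'c \<Rightarrow> real^'d \<Rightarrow> real^'c) \<Rightarrow> ('d::finite) dg_element \<Rightarrow>
   ('c::finite \<Rightarrow> real vec) \<Rightarrow> nat \<Rightarrow> real^'c" where
  "qtilde_v S \<beta> K u n = beta_inv S \<beta> (beta_v \<beta> K u n) (xv K n)"

definition qtilde_f ::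
  "(real^'c) set \<Rightarrow> (real^'c \<Rightarrow> real^'d \<Rightarrow> real^'c) \<Rightarrow> ('d::finite) dg_element \<Rightarrow>
   ('c::finite \<Rightarrow> real vec) \<Rightarrow> nat \<Rightarrow> real^'c" where
  "qtilde_f S \<beta> K u n = beta_inv S \<beta> (beta_f \<beta> K u n) (xf K n)"

definition qtilde ::
  "(real^'c) set \<Rightarrow> (real^'c \<Rightarrow> real^'d \<Rightarrow> real^'c) \<Rightarrow> ('d::finite) dg_element \<Rightarrow>
   ('c::finite \<Rightarrow> real vec) \<Rightarrow> nat \<Rightarrow> real^'c" where
  "qtilde S \<beta> K u n = beta_inv S \<beta> (beta_c \<beta> K u n) (xc K n)"

definition vol_flux_mat ::
  "(real^'c) set \<Rightarrow> (real^'c \<Rightarrow> real^'d \<Rightarrow> real^'c) \<Rightarrow>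
   ('d \<Rightarrow> real^'c \<Rightarrow> real^'d \<Rightarrow> real^'c \<Rightarrow> real^'d \<Rightarrow> real^'c) \<Rightarrow>
   ('d::finite) dg_element \<Rightarrow> ('c::finite \<Rightarrow> real vec) \<Rightarrow> 'd \<Rightarrow> 'c \<Rightarrow> real mat" where
  "vol_flux_mat S \<beta> D K u j \<alpha> = mat (nqv K + nqf K) (nqv K + nqf K)
     (\<lambda>(n, m). D j (qtilde S \<beta> K u n) (xc K n) (qtilde S \<beta> K u m) (xc K m) $h \<alpha>)"

definition source_vec ::
  "(real^'c) set \<Rightarrow> (real^'c \<Rightarrow> real^'d \<Rightarrow> real^'c) \<Rightarrow> (real^'c \<Rightarrow> real^'d \<Rightarrow> real^'c) \<Rightarrow>
   ('d::finite) dg_element \<Rightarrow> ('c::finite \<Rightarrow> real vec) \<Rightarrow> 'c \<Rightarrow> real vec" where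
  "source_vec S \<beta> g K u \<alpha> = vec (nqv K) (\<lambda>n. g (qtilde_v S \<beta> K u n) (xv K n) $h \<alpha>)"

definition surf_flux_vec ::
  "(real^'c) set \<Rightarrow> (real^'c \<Rightarrow> real^'d \<Rightarrow> real^'c) \<Rightarrow>
   ('d \<Rightarrow> real^'d \<Rightarrow> real^'c \<Rightarrow> real^'d \<Rightarrow> real^'c \<Rightarrow> real^'d \<Rightarrow> real^'c) \<Rightarrow>
   ('d dg_element \<times> nat \<Rightarrow> 'd dg_element \<times> nat) \<Rightarrow>
   ('d dg_element \<Rightarrow> 'c \<Rightarrow> real vec) \<Rightarrow> ('d::finite) dg_element \<Rightarrow> 'd \<Rightarrow> 'c::finite \<Rightarrow> real vec" where
  "surf_flux_vec S \<beta> Ds nbr u K j \<alpha> = vec (nqf K) (\<lambda>n. case nbr (K, n) of (K', n') \<Rightarrow>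
     Ds j (out_normal K n) (qtilde_f S \<beta> K (u K) n) (xf K n) (qtilde_f S \<beta> K' (u K') n') (xf K' n') $h \<alpha>)"

text \<open>
  \<open>u t K \<alpha>\<close> are the coefficients of component \<open>\<alpha>\<close> on \<open>K\<close> at time \<open>t\<close>.
  The two membership conditions say that the nodal states are admissible and that the entropy
  projection is defined; they are void if \<open>S\<close> is the whole space and \<open>\<lambda>q. \<beta> q x\<close> is a bijection of it.
\<close>

definition dg_solution ::
  "('d::finite) dg_element set \<Rightarrow> ('d dg_element \<times> nat \<Rightarrow> 'd dg_element \<times> nat) \<Rightarrow>
   (real^'c) set \<Rightarrow> (real^'c \<Rightarrow> real^'d \<Rightarrow> real^'c) \<Rightarrow> (real^'c \<Rightarrow> real^'d \<Rightarrow> real^'c) \<Rightarrow>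
   ('d \<Rightarrow> real^'c \<Rightarrow> real^'d \<Rightarrow> real^'c \<Rightarrow> real^'d \<Rightarrow> real^'c) \<Rightarrow>
   ('d \<Rightarrow> real^'d \<Rightarrow> real^'c \<Rightarrow> real^'d \<Rightarrow> real^'c \<Rightarrow> real^'d \<Rightarrow> real^'c) \<Rightarrow>
   real set \<Rightarrow> (real \<Rightarrow> 'd dg_element \<Rightarrow> 'c::finite \<Rightarrow> real vec) \<Rightarrow> bool" where
  "dg_solution T nbr S \<beta> g D Ds I u \<longleftrightarrow>
     (\<forall>t\<in>I. \<forall>K\<in>T.
        (\<forall>\<alpha>. u t K \<alpha> \<in> carrier_vec (np K)) \<and>
        (\<forall>\<alpha>. \<forall>m<np K. (\<lambda>s. u s K \<alpha> $ m) differentiable (at t within I)) \<and>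
        (\<forall>n<nqv K. qv K (u t K) n \<in> S) \<and>
        (\<forall>n<nqv K + nqf K. beta_c \<beta> K (u t K) n \<in> (\<lambda>q. \<beta> q (xc K n)) ` S) \<and>
        (\<forall>\<alpha>.
          Mv K *\<^sub>v vec (np K) (\<lambda>m. vector_derivative (\<lambda>s. u s K \<alpha> $ m) (at t within I))
          + (Vc K)\<^sup>T *\<^sub>v sum_vec (nqv K + nqf K) (\<lambda>j. sum_vec (nqv K + nqf K) (\<lambda>k.
              (Gc K j k * (Qc K k \<circ>\<^sub>h vol_flux_mat S \<beta> D K (u t K) j \<alpha>)
               - (vol_flux_mat S \<beta> D K (u t K) j \<alpha> \<circ>\<^sub>h (Qc K k)\<^sup>T) * Gc K j k)
              *\<^sub>v ones (nqv K + nqf K)))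
          = (Vv K)\<^sup>T * Jv K * Wv K *\<^sub>v source_vec S \<beta> g K (u t K) \<alpha>
          - sum_vec (np K) (\<lambda>j. sum_vec (np K) (\<lambda>k.
              (Vf K)\<^sup>T * Gf K j k * Bf K k *\<^sub>v surf_flux_vec S \<beta> Ds nbr (u t) K j \<alpha>))))"

end

theory Submission
  imports Defs
begin

text \<open>
  The scheme on an element \<open>K\<close> is tested with the coefficients \<open>\<beta>\<^sup>N = P\<^sup>v \<beta>(q\<^sup>v)\<close> of the projected entropy
  variables and summed over the components of the system.  The four terms become the following.

  Since \<open>(P\<^sup>v)\<^sup>T M\<^sup>v = J\<^sup>v W\<^sup>v V\<^sup>v\<close>, the projection drops out of the time derivative, which turns into the
  quadrature of \<open>\<beta>(q\<^sup>v) \<cdot> dq\<^sup>v/dt\<close> (\<open>mass_term\<close>), that is, of the time derivative of the entropy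
  (\<open>entropy_chain_rule\<close>).

  In the volume term and the source term, the test vector at the nodes is \<open>V \<beta>\<^sup>N\<close>, the vector of entropy
  variables of the projected state.  The source therefore gives the quadrature of the entropy
  production (\<open>source_term\<close>).  In the flux differences, exchanging the two node indices leaves
  the left-hand side of the conservative shuffle relation, so the fluxes are replaced by differences
  \<open>\<zeta>\<^sub>m - \<zeta>\<^sub>n\<close> of entropy fluxes.  The terms with \<open>\<zeta>\<^sub>n\<close> vanish because the rows of \<open>Q\<close> sum to zero; in those
  with \<open>\<zeta>\<^sub>m\<close>, \<open>Q + Q\<^sup>T = diag (0, B\<^sup>f)\<close> and the discrete geometric conservation law leave only the entropy
  flux through the surface nodes (\<open>flux_difference_sum\<close>, \<open>volume_term\<close>).

  Together with the contracted surface flux (\<open>surface_term\<close>) this yields an exact entropy balance on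
  \<open>K\<close> (\<open>element_entropy_balance\<close>), whose last term is a sum of outflows over the surface nodes.  Summed
  over the mesh, the outflows can be collected over pairs of matched surface nodes.  The scaled
  normals, and hence the unit normals, of such a pair are opposite (\<open>periodic_mesh_nbr\<close>), and the
  dissipative shuffle relation, multiplied by the positive factor \<open>w\<^sup>f J\<^sup>f\<close>, says that the outflows of a
  pair have a nonnegative sum (\<open>face_entropy_outflow\<close>).
\<close>

section \<open>Matrix and vector preliminaries\<close>

lemma scalar_prod_sum:
  "y \<in> carrier_vec n \<Longrightarrow> x \<bullet> y = (\<Sum>i<n. x $ i * y $ i)" for x y :: "real vec"
  unfolding scalar_prod_def by (auto simp: atLeast0LessThan)

lemma mult_mat_vec_sum:
  fixes A :: "real mat"
  assumes "A \<in> carrier_mat nr nc" "x \<in> carrier_vec nc" "i < nr"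
  shows "(A *\<^sub>v x) $ i = (\<Sum>j<nc. A $$ (i, j) * x $ j)"
  using assms by (auto simp: scalar_prod_def atLeast0LessThan)

lemma mat_diag_mult_vec:
  fixes f :: "nat \<Rightarrow> real"
  assumes "x \<in> carrier_vec n"
  shows "mat_diag n f *\<^sub>v x = vec n (\<lambda>i. f i * x $ i)"
proof (rule eq_vecI)
  fix i assume "i < dim_vec (vec n (\<lambda>i. f i * x $ i))"
  then have i: "i < n" by simp
  have "(mat_diag n f *\<^sub>v x) $ i = (\<Sum>j<n. (if i = j then f j else 0) * x $ j)"
    using i by (subst mult_mat_vec_sum[OF mat_diag_dim assms i]) (auto simp: mat_diag_def)
  also have "\<dots> = (\<Sum>j<n. if i = j then f j * x $ j else 0)"
    by (rule sum.cong) auto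
  also have "\<dots> = f i * x $ i" using i by simp
  finally show "(mat_diag n f *\<^sub>v x) $ i = vec n (\<lambda>i. f i * x $ i) $ i" using i by simp
qed (auto simp: mat_diag_def)

lemma scalar_prod_mat_diag:
  fixes f :: "nat \<Rightarrow> real"
  assumes "y \<in> carrier_vec n"
  shows "x \<bullet> (mat_diag n f *\<^sub>v y) = (\<Sum>i<n. f i * (x $ i * y $ i))"
  by (subst scalar_prod_sum[where n = n]) (auto simp: mat_diag_mult_vec[OF assms] intro!: sum.cong)

lemma scalar_prod_transpose:
  fixes A :: "real mat"
  assumes "A \<in> carrier_mat nr nc" "x \<in> carrier_vec nc" "y \<in> carrier_vec nr"
  shows "x \<bullet> (A\<^sup>T *\<^sub>v y) = (A *\<^sub>v x) \<bullet> y"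
proof -
  have "x \<bullet> (A\<^sup>T *\<^sub>v y) = (A\<^sup>T *\<^sub>v y) \<bullet> x"
    using assms by (intro comm_scalar_prod[of _ nc]) auto
  also have "\<dots> = y \<bullet> (A *\<^sub>v x)" by (rule transpose_vec_mult_scalar[OF assms])
  also have "\<dots> = (A *\<^sub>v x) \<bullet> y"
    using assms by (intro comm_scalar_prod[of _ nr]) auto
  finally show ?thesis .
qed

lemma mat_inverse_invertible:
  fixes A :: "real mat"
  assumes "A \<in> carrier_mat n n" "invertible_mat A"
  shows "the (mat_inverse A) \<in> carrier_mat n n" "A * the (mat_inverse A) = 1\<^sub>m n"
proof -
  obtain B where B: "A * B = 1\<^sub>m (dim_row A)" "B * A = 1\<^sub>m (dim_row B)"
    using assms(2) unfolding invertible_mat_def inverts_mat_def by blast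
  have r: "dim_row A = n" using assms(1) by simp
  have "dim_col (A * B) = n" "dim_col (B * A) = dim_row B"
    using B r by (simp, metis index_one_mat(3))
  then have Bc: "B \<in> carrier_mat n n" using assms(1) by auto
  have "A \<in> Units (ring_mat TYPE(real) n undefined)"
    using assms(1) B Bc r unfolding Units_def ring_mat_def by auto
  then obtain C where C: "mat_inverse A = Some C"
    using mat_inverse(1)[OF assms(1), where b = undefined] by (cases "mat_inverse A") auto
  from mat_inverse(2)[OF assms(1) C] C
  show "the (mat_inverse A) \<in> carrier_mat n n" "A * the (mat_inverse A) = 1\<^sub>m n" by auto
qed

lemma append_rows_mult_vec:
  fixes A :: "real mat"
  assumes "A \<in> carrier_mat nr1 nc" "B \<in> carrier_mat nr2 nc" "x \<in> carrier_vec nc"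
    and "i < nr1 + nr2"
  shows "((A @\<^sub>r B) *\<^sub>v x) $ i = (if i < nr1 then (A *\<^sub>v x) $ i else (B *\<^sub>v x) $ (i - nr1))"
  by (subst mat_mult_append[OF assms(1-3)]) (use assms in auto)

section \<open>Discretization matrices\<close>

lemma discretization_carriers [simp]:
  shows "Vv K \<in> carrier_mat (nqv K) (np K)" "Vf K \<in> carrier_mat (nqf K) (np K)"
    "Vc K \<in> carrier_mat (nqv K + nqf K) (np K)"
    "Wv K \<in> carrier_mat (nqv K) (nqv K)" "Jv K \<in> carrier_mat (nqv K) (nqv K)"
    "Wf K \<in> carrier_mat (nqf K) (nqf K)" "Bf K i \<in> carrier_mat (nqf K) (nqf K)"
    "Gf K j k \<in> carrier_mat (nqf K) (nqf K)" "Gv K j k \<in> carrier_mat (nqv K) (nqv K)"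
    "Gc K j k \<in> carrier_mat (nqv K + nqf K) (nqv K + nqf K)"
    "Mv K \<in> carrier_mat (np K) (np K)"
    "ones n \<in> carrier_vec n" "sum_vec n v \<in> carrier_vec n"
  by (auto simp: Vv_def Vf_def Vc_def Wv_def Jv_def Wf_def Bf_def Gf_def Gv_def Gc_def Mv_def
      ones_def sum_vec_def mat_diag_def)

lemma Bf_diag:
  "Bf K i = mat_diag (nqf K) (\<lambda>n. weight_f K n * ref_normal K n $h i * ref_face_jac K n)"
  by (simp add: Bf_def Wf_def)

text \<open>The diagonal of the metric matrix \<open>G\<^sub>j\<^sub>k\<close> at the combined nodes.\<close>

definition met_c :: "('d::finite) dg_element \<Rightarrow> 'd \<Rightarrow> 'd \<Rightarrow> nat \<Rightarrow> real" where
  "met_c K j k n = (if n < nqv K then met_v K j k n else met_f K j k (n - nqv K))"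

lemma Gc_met_c: "Gc K j k = mat_diag (nqv K + nqf K) (met_c K j k)"
  by (rule eq_matI) (auto simp: Gc_def Gv_def Gf_def met_c_def mat_diag_def four_block_mat_def Let_def)

lemma Jv_Wv_diag:
  "Jv K * Wv K = mat_diag (nqv K) (\<lambda>n. vol_jac K (node_v K n) * weight_v K n)"
  by (simp add: Jv_def Wv_def)

lemma volume_quadrature:
  "ones (nqv K) \<bullet> (Jv K * Wv K *\<^sub>v vec (nqv K) f)
   = (\<Sum>n<nqv K. vol_jac K (node_v K n) * weight_v K n * f n)"
  unfolding Jv_Wv_diag by (subst scalar_prod_mat_diag) (auto simp: ones_def)

lemma Pv_carrier:
  assumes "valid_element K"
  shows "Pv K \<in> carrier_mat (np K) (nqv K)"
proof -
  have "the (mat_inverse (Mv K)) \<in> carrier_mat (np K) (np K)"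
    using assms by (intro mat_inverse_invertible) (auto simp: valid_element_def)
  then show ?thesis unfolding Pv_def
    by (intro mult_carrier_mat[of _ _ "nqv K"] mult_carrier_mat[of _ _ "np K"]) auto
qed

lemma Mv_Pv:
  assumes "valid_element K"
  shows "Mv K * Pv K = (Vv K)\<^sup>T * (Jv K * Wv K)"
proof -
  let ?R = "the (mat_inverse (Mv K))"
  have inv: "?R \<in> carrier_mat (np K) (np K)" "Mv K * ?R = 1\<^sub>m (np K)"
    using assms by (auto intro!: mat_inverse_invertible simp: valid_element_def)
  have VT: "(Vv K)\<^sup>T \<in> carrier_mat (np K) (nqv K)" by simp
  have JW: "Jv K * Wv K \<in> carrier_mat (nqv K) (nqv K)" by (simp add: Jv_Wv_diag)
  have "Pv K = ?R * ((Vv K)\<^sup>T * (Jv K * Wv K))"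
    unfolding Pv_def
    using assoc_mult_mat[OF mult_carrier_mat[OF inv(1) VT] discretization_carriers(5,4)]
      assoc_mult_mat[OF inv(1) VT JW] by simp
  then have "Mv K * Pv K = (Mv K * ?R) * ((Vv K)\<^sup>T * (Jv K * Wv K))"
    using assoc_mult_mat[OF _ inv(1) mult_carrier_mat[OF VT JW], of "Mv K" "np K"] by simp
  then show ?thesis using inv(2) left_mult_one_mat[OF mult_carrier_mat[OF VT JW]] by simp
qed

lemma Mv_symmetric: "(Mv K)\<^sup>T = Mv K"
proof -
  have c: "Wv K * Jv K = Jv K * Wv K" by (simp add: Jv_def Wv_def mult.commute)
  have d: "(Jv K * Wv K)\<^sup>T = Jv K * Wv K" unfolding Jv_Wv_diag by (rule eq_matI) (auto simp: mat_diag_def)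
  have M: "Mv K = (Vv K)\<^sup>T * (Jv K * Wv K) * Vv K"
    unfolding Mv_def using assoc_mult_mat[of "(Vv K)\<^sup>T" "np K" "nqv K" "Wv K" "nqv K" "Jv K" "nqv K"] c by simp
  have JW: "Jv K * Wv K \<in> carrier_mat (nqv K) (nqv K)" by (simp add: Jv_Wv_diag)
  have "(Mv K)\<^sup>T = (Vv K)\<^sup>T * ((Vv K)\<^sup>T * (Jv K * Wv K))\<^sup>T"
    unfolding M using JW
    by (intro transpose_mult[of _ "np K" "nqv K" _ "np K"] mult_carrier_mat[of _ _ "nqv K"]) auto
  also have "((Vv K)\<^sup>T * (Jv K * Wv K))\<^sup>T = (Jv K * Wv K)\<^sup>T * Vv K"
    using JW by (subst transpose_mult[of _ "np K" "nqv K" _ "nqv K"]) auto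
  also have "(Vv K)\<^sup>T * ((Jv K * Wv K)\<^sup>T * Vv K) = Mv K"
    unfolding M d using JW
    by (intro assoc_mult_mat[symmetric, of _ "np K" "nqv K" _ "nqv K" _ "np K"]) auto
  finally show ?thesis .
qed

text \<open>\<open>Pv K\<close> is the orthogonal projection for the discrete bilinear form with weights \<open>J\<^sup>v W\<^sup>v\<close>: in the
  pairing with an expansion \<open>c\<close>, a projected vector of nodal values may be replaced by the vector
  itself.  The proof is \<open>(P\<^sup>v)\<^sup>T M\<^sup>v = J\<^sup>v W\<^sup>v V\<^sup>v\<close>; positivity of the weights plays no role.\<close>

lemma Pv_orthogonal:
  assumes K: "valid_element K" and w: "w \<in> carrier_vec (nqv K)" and c: "c \<in> carrier_vec (np K)"
  shows "(Pv K *\<^sub>v w) \<bullet> (Mv K *\<^sub>v c) =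
    (\<Sum>n<nqv K. vol_jac K (node_v K n) * weight_v K n * (w $ n * (Vv K *\<^sub>v c) $ n))"
proof -
  note P = Pv_carrier[OF K]
  have JW: "Jv K * Wv K \<in> carrier_mat (nqv K) (nqv K)" by (simp add: Jv_Wv_diag)
  have Pw: "Pv K *\<^sub>v w \<in> carrier_vec (np K)" using P w by auto
  have "(Pv K *\<^sub>v w) \<bullet> (Mv K *\<^sub>v c) = ((Mv K)\<^sup>T *\<^sub>v (Pv K *\<^sub>v w)) \<bullet> c"
    using Pw c by (subst transpose_vec_mult_scalar[of _ "np K" "np K"]) auto
  also have "(Mv K)\<^sup>T *\<^sub>v (Pv K *\<^sub>v w) = (Mv K * Pv K) *\<^sub>v w"
    unfolding Mv_symmetric using assoc_mult_mat_vec[OF _ P w, of "Mv K" "np K"] by simp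
  also have "\<dots> = (Vv K)\<^sup>T *\<^sub>v (Jv K * Wv K *\<^sub>v w)"
    unfolding Mv_Pv[OF K] using assoc_mult_mat_vec[OF _ JW w, of "(Vv K)\<^sup>T" "np K"] by simp
  also have "((Vv K)\<^sup>T *\<^sub>v (Jv K * Wv K *\<^sub>v w)) \<bullet> c = (Jv K * Wv K *\<^sub>v w) \<bullet> (Vv K *\<^sub>v c)"
    using c JW w by (intro transpose_vec_mult_scalar[of _ "nqv K" "np K"]) auto
  also have "\<dots> = (\<Sum>n<nqv K. vol_jac K (node_v K n) * weight_v K n * (w $ n * (Vv K *\<^sub>v c) $ n))"
    unfolding Jv_Wv_diag mat_diag_mult_vec[OF w]
    by (subst scalar_prod_sum[where n = "nqv K"]) (use c in \<open>auto intro!: sum.cong mult_mat_vec_carrier\<close>)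
  finally show ?thesis .
qed

lemma Qv_carrier:
  assumes "valid_element K"
  shows "Qv K i \<in> carrier_mat (nqv K) (nqv K)"
  using Pv_carrier[OF assms] unfolding Qv_def
  by (intro carrier_matI) (auto simp: Wv_def mat_diag_def)

lemma Qc_carrier:
  assumes "valid_element K"
  shows "Qc K i \<in> carrier_mat (nqv K + nqf K) (nqv K + nqf K)"
  using Qv_carrier[OF assms, of i] unfolding Qc_def
  by (intro smult_carrier_mat four_block_carrier_mat) auto

text \<open>The summation-by-parts property \<open>Q + Q\<^sup>T = diag (0, B\<^sup>f)\<close>, entry by entry.\<close>

lemma Qc_summation_by_parts:
  assumes K: "valid_element K" and n: "n < nqv K + nqf K" and m: "m < nqv K + nqf K"
  shows "Qc K i $$ (n, m) + Qc K i $$ (m, n) =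
    (if n = m \<and> nqv K \<le> n then Bf K i $$ (n - nqv K, n - nqv K) else 0)"
proof -
  note P = Pv_carrier[OF K]
  note Q = Qv_carrier[OF K, of i]
  have E: "Ev K \<in> carrier_mat (nqf K) (nqv K)"
    using P unfolding Ev_def by (intro mult_carrier_mat) auto
  define b where "b = (\<lambda>n. weight_f K n * ref_normal K n $h i * ref_face_jac K n)"
  have B: "Bf K i = mat_diag (nqf K) b" by (simp add: Bf_diag b_def)
  have EB: "(Ev K)\<^sup>T * Bf K i = mat (nqv K) (nqf K) (\<lambda>(n, m). Ev K $$ (m, n) * b m)"
    unfolding B using E by (subst mat_diag_mult_right[of _ "nqv K"]) (auto intro!: eq_matI)
  have BE: "- (Bf K i * Ev K) = mat (nqf K) (nqv K) (\<lambda>(n, m). - (Ev K $$ (n, m) * b n))"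
    unfolding B using E by (subst mat_diag_mult_left[of _ _ "nqv K"]) (auto intro!: eq_matI)
  show ?thesis unfolding Qc_def EB BE using Q n m
    by (auto simp: four_block_mat_def Let_def B mat_diag_def diff_divide_distrib)
qed

lemma Qc_row_sum:
  assumes K: "valid_element K" and n: "n < nqv K + nqf K"
  shows "(\<Sum>m<nqv K + nqf K. Qc K i $$ (n, m)) = 0"
proof -
  have "(Qc K i *\<^sub>v ones (nqv K + nqf K)) $ n = 0"
    using K n unfolding valid_element_def by simp
  then show ?thesis
    by (subst (asm) mult_mat_vec_sum[OF Qc_carrier[OF K] _ n]) (auto simp: ones_def)
qed

lemma geometric_conservation:
  assumes K: "valid_element K" and n: "n < nqv K + nqf K"
  shows "(\<Sum>k\<in>UNIV. \<Sum>m<nqv K + nqf K. Qc K k $$ (n, m) * met_c K j k m) = 0"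
proof -
  let ?N = "nqv K + nqf K"
  note Q = Qc_carrier[OF K]
  have "(\<Sum>k\<in>UNIV. (Qc K k * Gc K j k *\<^sub>v ones ?N) $ n)
      = sum_vec ?N (\<lambda>k. Qc K k * Gc K j k *\<^sub>v ones ?N) $ n"
    using n by (simp add: sum_vec_def)
  also have "\<dots> = 0" using K n unfolding valid_element_def by simp
  finally have "(\<Sum>k\<in>UNIV. (Qc K k * Gc K j k *\<^sub>v ones ?N) $ n) = 0" .
  moreover have "(Qc K k * Gc K j k *\<^sub>v ones ?N) $ n = (\<Sum>m<?N. Qc K k $$ (n, m) * met_c K j k m)" for k
  proof -
    have "(Qc K k * Gc K j k *\<^sub>v ones ?N) $ n = (\<Sum>m<?N. (Qc K k * Gc K j k) $$ (n, m) * ones ?N $ m)"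
      using n Q by (intro mult_mat_vec_sum) (auto intro!: mult_carrier_mat)
    also have "\<dots> = (\<Sum>m<?N. Qc K k $$ (n, m) * met_c K j k m)"
      unfolding Gc_met_c mat_diag_mult_right[OF Q] using n by (intro sum.cong) (auto simp: ones_def)
    finally show ?thesis .
  qed
  ultimately show ?thesis by simp
qed

section \<open>Flux differencing\<close>

text \<open>
  Here \<open>E n m\<close> is the contraction of the two-point flux \<open>D(q\<^sub>n, q\<^sub>m)\<close> with the entropy variables at the
  node \<open>n\<close>.  Exchanging the summation indices in the second half of the flux differences leaves only
  \<open>E n m - E m n\<close>, which the shuffle relation turns into differences of the entropy flux; these
  are moved to the boundary by summation by parts.
\<close>

lemma flux_difference_sum:
  fixes Q :: "'k \<Rightarrow> nat \<Rightarrow> nat \<Rightarrow> real"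
  assumes shuffle: "\<And>n m. n < N \<Longrightarrow> m < N \<Longrightarrow> E n m - E m n = z m - z n"
    and rows: "\<And>k n. n < N \<Longrightarrow> (\<Sum>m<N. Q k n m) = 0"
    and gcl: "\<And>n. n < N \<Longrightarrow> (\<Sum>k\<in>A. \<Sum>m<N. Q k n m * G k m) = 0"
    and sbp: "\<And>k n m. n < N \<Longrightarrow> m < N \<Longrightarrow> Q k n m + Q k m n = (if n = m then R k n else 0)"
  shows "(\<Sum>k\<in>A. \<Sum>n<N. \<Sum>m<N. G k n * Q k n m * E n m - E n m * Q k m n * G k m)
    = (\<Sum>k\<in>A. \<Sum>n<N. G k n * R k n * z n)"
proof -
  have step: "(\<Sum>n<N. \<Sum>m<N. G k n * Q k n m * E n m - E n m * Q k m n * G k m)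
      = (\<Sum>n<N. G k n * R k n * z n) - (\<Sum>m<N. z m * (\<Sum>n<N. Q k m n * G k n))" for k
  proof -
    have "(\<Sum>n<N. \<Sum>m<N. E n m * Q k m n * G k m) = (\<Sum>n<N. \<Sum>m<N. E m n * Q k n m * G k n)"
      by (rule sum.swap)
    then have "(\<Sum>n<N. \<Sum>m<N. G k n * Q k n m * E n m - E n m * Q k m n * G k m)
        = (\<Sum>n<N. \<Sum>m<N. G k n * Q k n m * (E n m - E m n))"
      by (simp add: sum_subtractf right_diff_distrib mult_ac)
    also have "\<dots> = (\<Sum>n<N. \<Sum>m<N. G k n * Q k n m * z m - G k n * z n * Q k n m)"
      by (intro sum.cong) (auto simp: shuffle algebra_simps)
    also have "\<dots> = (\<Sum>n<N. \<Sum>m<N. G k n * Q k n m * z m)"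
      by (simp add: sum_subtractf sum_distrib_left[symmetric] rows)
    also have "\<dots> = (\<Sum>n<N. \<Sum>m<N. (if n = m then G k n * R k n * z n else 0) - z m * (Q k m n * G k n))"
    proof (intro sum.cong refl)
      fix n m assume "n \<in> {..<N}" "m \<in> {..<N}"
      then have "(if n = m then R k n else 0) = Q k n m + Q k m n" using sbp[of n m k] by simp
      then show "G k n * Q k n m * z m = (if n = m then G k n * R k n * z n else 0) - z m * (Q k m n * G k n)"
        by (cases "n = m") (auto simp: algebra_simps eq_neg_iff_add_eq_0 simp flip: distrib_left)
    qed
    also have "\<dots> = (\<Sum>n<N. G k n * R k n * z n) - (\<Sum>n<N. \<Sum>m<N. z m * (Q k m n * G k n))"
      by (simp add: sum_subtractf)
    also have "(\<Sum>n<N. \<Sum>m<N. z m * (Q k m n * G k n)) = (\<Sum>m<N. z m * (\<Sum>n<N. Q k m n * G k n))"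
      by (subst sum.swap) (simp add: sum_distrib_left)
    finally show ?thesis .
  qed
  have "(\<Sum>k\<in>A. \<Sum>m<N. z m * (\<Sum>n<N. Q k m n * G k n)) = (\<Sum>m<N. z m * (\<Sum>k\<in>A. \<Sum>n<N. Q k m n * G k n))"
    by (subst sum.swap) (simp add: sum_distrib_left)
  also have "\<dots> = 0" by (simp add: gcl)
  finally have "(\<Sum>k\<in>A. (\<Sum>n<N. G k n * R k n * z n) - (\<Sum>m<N. z m * (\<Sum>n<N. Q k m n * G k n)))
      = (\<Sum>k\<in>A. \<Sum>n<N. G k n * R k n * z n)"
    by (subst sum_subtractf) simp
  then show ?thesis by (simp only: step)
qed

section \<open>The scheme tested with the projected entropy variables\<close>

lemma inner_node_value: "inner b (node_value v n) = (\<Sum>\<alpha>\<in>UNIV. b $h \<alpha> * v \<alpha> $ n)"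
  by (simp add: inner_vec_def node_value_def)

lemma betaN_carrier: "valid_element K \<Longrightarrow> betaN \<beta> K u \<alpha> \<in> carrier_vec (np K)"
  unfolding betaN_def using Pv_carrier by (intro mult_mat_vec_carrier) auto

lemma beta_c_volume:
  assumes "valid_element K" "n < nqv K"
  shows "beta_c \<beta> K u n = beta_v \<beta> K u n"
  using assms unfolding beta_c_def beta_v_def node_value_def Vc_def
  by (simp add: Finite_Cartesian_Product.vec_eq_iff append_rows_mult_vec[OF discretization_carriers(1,2) betaN_carrier])

lemma beta_c_surface:
  assumes "valid_element K" "n < nqf K"
  shows "beta_c \<beta> K u (nqv K + n) = beta_f \<beta> K u n"
  using assms unfolding beta_c_def beta_f_def node_value_def Vc_def
  by (simp add: Finite_Cartesian_Product.vec_eq_iff append_rows_mult_vec[OF discretization_carriers(1,2) betaN_carrier])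

text \<open>By the orthogonality of the projection, the time derivative is tested with the entropy variables
  of the unprojected state, as the chain rule for the entropy requires.\<close>

lemma mass_term:
  assumes K: "valid_element K" and c: "\<And>\<alpha>. c \<alpha> \<in> carrier_vec (np K)"
  shows "(\<Sum>\<alpha>\<in>UNIV. betaN \<beta> K u \<alpha> \<bullet> (Mv K *\<^sub>v c \<alpha>)) =
    (\<Sum>n<nqv K. vol_jac K (node_v K n) * weight_v K n *
       inner (\<beta> (qv K u n) (xv K n)) (node_value (\<lambda>\<alpha>. Vv K *\<^sub>v c \<alpha>) n))"
  unfolding betaN_def Pv_orthogonal[OF K vec_carrier c]
  by (subst sum.swap) (auto simp: inner_node_value sum_distrib_left intro!: sum.cong)

lemma source_term:
  assumes K: "valid_element K"
  shows "(\<Sum>\<alpha>\<in>UNIV. betaN \<beta> K u \<alpha> \<bullet> ((Vv K)\<^sup>T * Jv K * Wv K *\<^sub>v source_vec S \<beta> g K u \<alpha>)) =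
    (\<Sum>n<nqv K. vol_jac K (node_v K n) * weight_v K n *
       inner (beta_v \<beta> K u n) (g (qtilde_v S \<beta> K u n) (xv K n)))"
proof -
  have JW: "Jv K * Wv K \<in> carrier_mat (nqv K) (nqv K)" by (simp add: Jv_Wv_diag)
  have "betaN \<beta> K u \<alpha> \<bullet> ((Vv K)\<^sup>T * Jv K * Wv K *\<^sub>v source_vec S \<beta> g K u \<alpha>) =
     (\<Sum>n<nqv K. vol_jac K (node_v K n) * weight_v K n *
       ((Vv K *\<^sub>v betaN \<beta> K u \<alpha>) $ n * g (qtilde_v S \<beta> K u n) (xv K n) $h \<alpha>))" for \<alpha>
  proof -
    have s: "source_vec S \<beta> g K u \<alpha> \<in> carrier_vec (nqv K)" by (simp add: source_vec_def)
    have "(Vv K)\<^sup>T * Jv K * Wv K *\<^sub>v source_vec S \<beta> g K u \<alpha>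
        = (Vv K)\<^sup>T *\<^sub>v (Jv K * Wv K *\<^sub>v source_vec S \<beta> g K u \<alpha>)"
      using assoc_mult_mat[of "(Vv K)\<^sup>T" "np K" "nqv K" "Jv K" "nqv K" "Wv K" "nqv K"]
        assoc_mult_mat_vec[OF _ JW s, of "(Vv K)\<^sup>T" "np K"] by simp
    also have "betaN \<beta> K u \<alpha> \<bullet> \<dots> = (Vv K *\<^sub>v betaN \<beta> K u \<alpha>) \<bullet> (Jv K * Wv K *\<^sub>v source_vec S \<beta> g K u \<alpha>)"
      using JW s betaN_carrier[OF K] by (intro scalar_prod_transpose[of _ "nqv K" "np K"]) auto
    also have "\<dots> = (\<Sum>n<nqv K. vol_jac K (node_v K n) * weight_v K n *
       ((Vv K *\<^sub>v betaN \<beta> K u \<alpha>) $ n * g (qtilde_v S \<beta> K u n) (xv K n) $h \<alpha>))"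
      unfolding Jv_Wv_diag scalar_prod_mat_diag[OF s] by (auto simp: source_vec_def intro!: sum.cong)
    finally show ?thesis .
  qed
  then show ?thesis
    by (simp only:, subst sum.swap)
      (auto simp: beta_v_def inner_vec_def node_value_def sum_distrib_left intro!: sum.cong)
qed

text \<open>The diagonal entries of \<open>\<Sum>\<^sub>k G\<^sup>f\<^sub>j\<^sub>k B\<^sup>f\<^sub>k\<close>, which are the components of the outward unit normal scaled by
  the surface quadrature weight and the surface Jacobian.\<close>

definition scaled_normal :: "('d::finite) dg_element \<Rightarrow> nat \<Rightarrow> 'd \<Rightarrow> real" where
  "scaled_normal K n j = weight_f K n * (face_jac K n * out_normal K n $h j)"

lemma sum_Gf_Bf:
  assumes K: "valid_element K" and n: "n < nqf K"
  shows "(\<Sum>k\<in>UNIV. met_f K j k n * Bf K k $$ (n, n)) = scaled_normal K n j"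
    and "sum_mat (nqf K) (nqf K) (\<lambda>k. Gf K j k * Bf K k) $$ (n, n) = scaled_normal K n j"
proof -
  show r: "sum_mat (nqf K) (nqf K) (\<lambda>k. Gf K j k * Bf K k) $$ (n, n) = scaled_normal K n j"
  proof -
    have "sum_mat (nqf K) (nqf K) (\<lambda>k. Gf K j k * Bf K k)
        = Wf K * mat_diag (nqf K) (\<lambda>n. face_jac K n * out_normal K n $h j)"
      using K unfolding valid_element_def by blast
    then show ?thesis using n by (simp only: Wf_def mat_diag_diag) (simp add: mat_diag_def scaled_normal_def)
  qed
  have "(Gf K j k * Bf K k) $$ (n, n) = met_f K j k n * Bf K k $$ (n, n)" for k
    unfolding Gf_def mat_diag_mult_left[OF discretization_carriers(7)] using n by simp
  then show "(\<Sum>k\<in>UNIV. met_f K j k n * Bf K k $$ (n, n)) = scaled_normal K n j"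
    using r n by (simp add: sum_mat_def)
qed

lemma surface_term:
  assumes K: "valid_element K" and f: "\<And>j \<alpha>. f j \<alpha> \<in> carrier_vec (nqf K)"
  shows "(\<Sum>\<alpha>\<in>UNIV. betaN \<beta> K u \<alpha> \<bullet> sum_vec (np K) (\<lambda>j. sum_vec (np K) (\<lambda>k.
              (Vf K)\<^sup>T * Gf K j k * Bf K k *\<^sub>v f j \<alpha>))) =
    (\<Sum>n<nqf K. \<Sum>j\<in>UNIV. scaled_normal K n j * inner (beta_f \<beta> K u n) (node_value (f j) n))"
proof -
  have GB: "Gf K j k * Bf K k \<in> carrier_mat (nqf K) (nqf K)" for j k
    by (rule mult_carrier_mat[of _ _ "nqf K"]) auto
  have *: "betaN \<beta> K u \<alpha> \<bullet> ((Vf K)\<^sup>T * Gf K j k * Bf K k *\<^sub>v f j \<alpha>) =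
     (\<Sum>n<nqf K. met_f K j k n * Bf K k $$ (n, n) * (beta_f \<beta> K u n $h \<alpha> * f j \<alpha> $ n))" for \<alpha> j k
  proof -
    have "(Vf K)\<^sup>T * Gf K j k * Bf K k *\<^sub>v f j \<alpha>
        = (Vf K)\<^sup>T *\<^sub>v (Gf K j k * Bf K k *\<^sub>v f j \<alpha>)"
      using assoc_mult_mat[of "(Vf K)\<^sup>T" "np K" "nqf K" "Gf K j k" "nqf K" "Bf K k" "nqf K"]
        assoc_mult_mat_vec[OF _ GB f, of "(Vf K)\<^sup>T" "np K"] by simp
    also have "betaN \<beta> K u \<alpha> \<bullet> \<dots> = (Vf K *\<^sub>v betaN \<beta> K u \<alpha>) \<bullet> (Gf K j k * Bf K k *\<^sub>v f j \<alpha>)"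
      using GB f betaN_carrier[OF K]
      by (intro scalar_prod_transpose[of _ "nqf K" "np K"] mult_mat_vec_carrier) auto
    also have "\<dots> = (\<Sum>n<nqf K. met_f K j k n * Bf K k $$ (n, n) * (beta_f \<beta> K u n $h \<alpha> * f j \<alpha> $ n))"
      unfolding Gf_def Bf_diag mat_diag_diag scalar_prod_mat_diag[OF f]
      by (auto simp: beta_f_def node_value_def mat_diag_def intro!: sum.cong)
    finally show ?thesis .
  qed
  have "betaN \<beta> K u \<alpha> \<bullet> sum_vec (np K) (\<lambda>j. sum_vec (np K) (\<lambda>k.
              (Vf K)\<^sup>T * Gf K j k * Bf K k *\<^sub>v f j \<alpha>))
      = (\<Sum>j\<in>UNIV. \<Sum>k\<in>UNIV. betaN \<beta> K u \<alpha> \<bullet> ((Vf K)\<^sup>T * Gf K j k * Bf K k *\<^sub>v f j \<alpha>))" for \<alpha>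
  proof -
    have c: "(Vf K)\<^sup>T * Gf K j k * Bf K k *\<^sub>v f j \<alpha> \<in> carrier_vec (np K)" for j k
      using f by (intro mult_mat_vec_carrier mult_carrier_mat[of _ _ "nqf K"]) auto
    show ?thesis
      by (simp add: scalar_prod_sum[OF c] scalar_prod_sum[where n = "np K"] sum_vec_def
          sum_distrib_left sum.swap[of _ "{..<np K}"])
  qed
  moreover have "(\<Sum>k\<in>UNIV. \<Sum>n<nqf K. met_f K j k n * Bf K k $$ (n, n) * (beta_f \<beta> K u n $h \<alpha> * f j \<alpha> $ n))
      = (\<Sum>n<nqf K. scaled_normal K n j * (beta_f \<beta> K u n $h \<alpha> * f j \<alpha> $ n))" for \<alpha> j
    by (subst sum.swap) (auto simp: sum_Gf_Bf(1)[OF K] simp flip: sum_distrib_right intro!: sum.cong)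
  ultimately have "(\<Sum>\<alpha>\<in>UNIV. betaN \<beta> K u \<alpha> \<bullet> sum_vec (np K) (\<lambda>j. sum_vec (np K) (\<lambda>k.
              (Vf K)\<^sup>T * Gf K j k * Bf K k *\<^sub>v f j \<alpha>)))
      = (\<Sum>\<alpha>\<in>UNIV. \<Sum>j\<in>UNIV. \<Sum>n<nqf K. scaled_normal K n j * (beta_f \<beta> K u n $h \<alpha> * f j \<alpha> $ n))"
    by (simp add: *)
  also have "\<dots> = (\<Sum>\<alpha>\<in>UNIV. \<Sum>n<nqf K. \<Sum>j\<in>UNIV. scaled_normal K n j * (beta_f \<beta> K u n $h \<alpha> * f j \<alpha> $ n))"
    by (intro sum.cong refl sum.swap)
  also have "\<dots> = (\<Sum>n<nqf K. \<Sum>\<alpha>\<in>UNIV. \<Sum>j\<in>UNIV. scaled_normal K n j * (beta_f \<beta> K u n $h \<alpha> * f j \<alpha> $ n))"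
    by (rule sum.swap)
  also have "\<dots> = (\<Sum>n<nqf K. \<Sum>j\<in>UNIV. \<Sum>\<alpha>\<in>UNIV. scaled_normal K n j * (beta_f \<beta> K u n $h \<alpha> * f j \<alpha> $ n))"
    by (intro sum.cong refl sum.swap)
  also have "\<dots> = (\<Sum>n<nqf K. \<Sum>j\<in>UNIV. scaled_normal K n j * inner (beta_f \<beta> K u n) (node_value (f j) n))"
    by (simp add: inner_node_value sum_distrib_left)
  finally show ?thesis .
qed

text \<open>The tested volume term is a pure boundary term: the entropy flux leaving \<open>K\<close>, computed from the
  entropy-projected surface states.  The projection makes this possible, since the test vector is
  then the vector of entropy variables of the very states in which the flux is evaluated.\<close>

lemma volume_term:
  fixes D :: "'d \<Rightarrow> real^'c \<Rightarrow> real^'d \<Rightarrow> real^'c \<Rightarrow> real^'d \<Rightarrow> real^'c"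
    and K :: "('d::finite) dg_element" and u :: "'c::finite \<Rightarrow> real vec"
  assumes K: "valid_element K"
    and shuffle: "conservative_entropy_shuffle S X \<beta> \<zeta> D"
    and xc: "\<And>n. n < nqv K + nqf K \<Longrightarrow> xc K n \<in> X"
    and qt: "\<And>n. n < nqv K + nqf K \<Longrightarrow> qtilde S \<beta> K u n \<in> S"
    and \<beta>qt: "\<And>n. n < nqv K + nqf K \<Longrightarrow> \<beta> (qtilde S \<beta> K u n) (xc K n) = beta_c \<beta> K u n"
  shows "(\<Sum>\<alpha>\<in>UNIV. betaN \<beta> K u \<alpha> \<bullet> ((Vc K)\<^sup>T *\<^sub>v
      sum_vec (nqv K + nqf K) (\<lambda>j. sum_vec (nqv K + nqf K) (\<lambda>k.
              (Gc K j k * (Qc K k \<circ>\<^sub>h vol_flux_mat S \<beta> D K u j \<alpha>)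
               - (vol_flux_mat S \<beta> D K u j \<alpha> \<circ>\<^sub>h (Qc K k)\<^sup>T) * Gc K j k)
              *\<^sub>v ones (nqv K + nqf K))))) =
    (\<Sum>n<nqf K. \<Sum>j\<in>UNIV. scaled_normal K n j * \<zeta> j (qtilde S \<beta> K u (nqv K + n)) (xf K n))"
proof -
  define N where "N = nqv K + nqf K"
  let ?F = "vol_flux_mat S \<beta> D K u"
  let ?M = "\<lambda>j k \<alpha>. Gc K j k * (Qc K k \<circ>\<^sub>h ?F j \<alpha>) - (?F j \<alpha> \<circ>\<^sub>h (Qc K k)\<^sup>T) * Gc K j k"
  define d where "d j n m = D j (qtilde S \<beta> K u n) (xc K n) (qtilde S \<beta> K u m) (xc K m)" for j n m
  define e where "e j n m = inner (beta_c \<beta> K u n) (d j n m)" for j n m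
  define R where "R k n = (if nqv K \<le> n then Bf K k $$ (n - nqv K, n - nqv K) else 0)" for k n
  define Q where "Q k n m = Qc K k $$ (n, m)" for k n m
  note Qcar = Qc_carrier[OF K, folded N_def]
  have Fcar: "?F j \<alpha> \<in> carrier_mat N N" for j \<alpha> by (simp add: vol_flux_mat_def N_def)
  have M: "(?M j k \<alpha> *\<^sub>v ones N) $ n =
      (\<Sum>m<N. met_c K j k n * Q k n m * d j n m $h \<alpha> - d j n m $h \<alpha> * Q k m n * met_c K j k m)"
    if n: "n < N" for j k \<alpha> n
  proof -
    have h1: "Qc K k \<circ>\<^sub>h ?F j \<alpha> \<in> carrier_mat N N" "?F j \<alpha> \<circ>\<^sub>h (Qc K k)\<^sup>T \<in> carrier_mat N N"
      using Qcar[of k] Fcar[of j \<alpha>] by (auto simp: hadamard_def)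
    have G: "Gc K j k = mat_diag N (met_c K j k)" by (simp add: Gc_met_c N_def)
    have c: "?M j k \<alpha> \<in> carrier_mat N N"
      using h1 by (auto simp: G mat_diag_def)
    have "(?M j k \<alpha> *\<^sub>v ones N) $ n = (\<Sum>m<N. ?M j k \<alpha> $$ (n, m) * ones N $ m)"
      by (rule mult_mat_vec_sum[OF c _ n]) simp
    also have "\<dots> = (\<Sum>m<N. met_c K j k n * Q k n m * d j n m $h \<alpha> - d j n m $h \<alpha> * Q k m n * met_c K j k m)"
      unfolding G mat_diag_mult_left[OF h1(1)] mat_diag_mult_right[OF h1(2)]
      using n Qcar[of k] Fcar[of j \<alpha>]
      by (intro sum.cong) (auto simp: ones_def hadamard_def Q_def vol_flux_mat_def N_def d_def)
    finally show ?thesis .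
  qed
  have T: "betaN \<beta> K u \<alpha> \<bullet> ((Vc K)\<^sup>T *\<^sub>v sum_vec N (\<lambda>j. sum_vec N (\<lambda>k. ?M j k \<alpha> *\<^sub>v ones N)))
      = (\<Sum>n<N. \<Sum>j\<in>UNIV. \<Sum>k\<in>UNIV. \<Sum>m<N. beta_c \<beta> K u n $h \<alpha> *
          (met_c K j k n * Q k n m * d j n m $h \<alpha> - d j n m $h \<alpha> * Q k m n * met_c K j k m))" for \<alpha>
  proof -
    have "betaN \<beta> K u \<alpha> \<bullet> ((Vc K)\<^sup>T *\<^sub>v sum_vec N (\<lambda>j. sum_vec N (\<lambda>k. ?M j k \<alpha> *\<^sub>v ones N)))
        = (Vc K *\<^sub>v betaN \<beta> K u \<alpha>) \<bullet> sum_vec N (\<lambda>j. sum_vec N (\<lambda>k. ?M j k \<alpha> *\<^sub>v ones N))"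
      using betaN_carrier[OF K] by (intro scalar_prod_transpose[of _ N "np K"]) (auto simp: N_def)
    also have "\<dots> = (\<Sum>n<N. beta_c \<beta> K u n $h \<alpha> * (\<Sum>j\<in>UNIV. \<Sum>k\<in>UNIV. (?M j k \<alpha> *\<^sub>v ones N) $ n))"
      by (subst scalar_prod_sum[where n = N]) (auto simp: sum_vec_def beta_c_def node_value_def)
    finally show ?thesis by (simp add: M sum_distrib_left)
  qed
  let ?s = "\<lambda>\<alpha> n j k m. beta_c \<beta> K u n $h \<alpha> *
          (met_c K j k n * Q k n m * d j n m $h \<alpha> - d j n m $h \<alpha> * Q k m n * met_c K j k m)"
  have swap: "(\<Sum>\<alpha>\<in>UNIV. \<Sum>n<N. \<Sum>j\<in>UNIV. \<Sum>k\<in>UNIV. \<Sum>m<N. ?s \<alpha> n j k m)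
      = (\<Sum>j\<in>UNIV. \<Sum>k\<in>UNIV. \<Sum>n<N. \<Sum>m<N. \<Sum>\<alpha>\<in>UNIV. ?s \<alpha> n j k m)"
  proof -
    \<comment> \<open>Only the sum over the components is moved inwards; the type instance keeps \<open>sum.swap\<close> from
      permuting the other sums.\<close>
    have "(\<Sum>\<alpha>\<in>UNIV. \<Sum>n<N. \<Sum>j\<in>UNIV. \<Sum>k\<in>UNIV. \<Sum>m<N. ?s \<alpha> n j k m)
        = (\<Sum>n<N. \<Sum>j\<in>UNIV. \<Sum>k\<in>UNIV. \<Sum>m<N. \<Sum>\<alpha>\<in>UNIV. ?s \<alpha> n j k m)"
      by (simp only: sum.swap[where A = "UNIV :: 'c set"])
    also have "\<dots> = (\<Sum>j\<in>UNIV. \<Sum>n<N. \<Sum>k\<in>UNIV. \<Sum>m<N. \<Sum>\<alpha>\<in>UNIV. ?s \<alpha> n j k m)"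
      by (rule sum.swap)
    also have "\<dots> = (\<Sum>j\<in>UNIV. \<Sum>k\<in>UNIV. \<Sum>n<N. \<Sum>m<N. \<Sum>\<alpha>\<in>UNIV. ?s \<alpha> n j k m)"
      by (rule sum.cong[OF refl], rule sum.swap)
    finally show ?thesis .
  qed
  have contract: "(\<Sum>\<alpha>\<in>UNIV. ?s \<alpha> n j k m) = met_c K j k n * Q k n m * e j n m - e j n m * Q k m n * met_c K j k m"
    for n j k m
    unfolding e_def inner_vec_def
    by (simp add: sum_distrib_left sum_distrib_right right_diff_distrib sum_subtractf mult_ac)
  have flux: "(\<Sum>k\<in>UNIV. \<Sum>n<N. \<Sum>m<N. met_c K j k n * Q k n m * e j n m - e j n m * Q k m n * met_c K j k m)
      = (\<Sum>k\<in>UNIV. \<Sum>n<N. met_c K j k n * R k n * \<zeta> j (qtilde S \<beta> K u n) (xc K n))" for j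
  proof (rule flux_difference_sum)
    fix n m assume "n < N" "m < N"
    then show "e j n m - e j m n = \<zeta> j (qtilde S \<beta> K u m) (xc K m) - \<zeta> j (qtilde S \<beta> K u n) (xc K n)"
      using shuffle xc qt \<beta>qt unfolding conservative_entropy_shuffle_def e_def d_def N_def by metis
  next
    fix k n m assume "n < N" "m < N"
    then show "Q k n m + Q k m n = (if n = m then R k n else 0)"
      using Qc_summation_by_parts[OF K] by (simp add: Q_def R_def N_def)
  qed (use Qc_row_sum[OF K] geometric_conservation[OF K] in \<open>simp_all add: Q_def N_def\<close>)
  have boundary: "(\<Sum>n<N. met_c K j k n * R k n * w n)
      = (\<Sum>n<nqf K. met_f K j k n * Bf K k $$ (n, n) * w (nqv K + n))" for j k and w :: "nat \<Rightarrow> real"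
  proof -
    have "(\<Sum>n<N. met_c K j k n * R k n * w n) = (\<Sum>n\<in>{nqv K..<nqv K + nqf K}. met_c K j k n * R k n * w n)"
      unfolding N_def by (rule sum.mono_neutral_right) (auto simp: R_def)
    also have "\<dots> = (\<Sum>n<nqf K. met_c K j k (nqv K + n) * R k (nqv K + n) * w (nqv K + n))"
      by (rule sum.reindex_bij_witness[of _ "\<lambda>n. nqv K + n" "\<lambda>n. n - nqv K"]) auto
    finally show ?thesis by (simp add: met_c_def R_def)
  qed
  have "(\<Sum>\<alpha>\<in>UNIV. betaN \<beta> K u \<alpha> \<bullet> ((Vc K)\<^sup>T *\<^sub>v sum_vec N (\<lambda>j. sum_vec N (\<lambda>k. ?M j k \<alpha> *\<^sub>v ones N))))
      = (\<Sum>j\<in>UNIV. \<Sum>k\<in>UNIV. \<Sum>n<nqf K. met_f K j k n * Bf K k $$ (n, n) *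
          \<zeta> j (qtilde S \<beta> K u (nqv K + n)) (xc K (nqv K + n)))"
    unfolding T swap contract flux boundary ..
  also have "\<dots> = (\<Sum>j\<in>UNIV. \<Sum>n<nqf K. scaled_normal K n j * \<zeta> j (qtilde S \<beta> K u (nqv K + n)) (xf K n))"
  proof (rule sum.cong[OF refl])
    fix j
    show "(\<Sum>k\<in>UNIV. \<Sum>n<nqf K. met_f K j k n * Bf K k $$ (n, n) *
          \<zeta> j (qtilde S \<beta> K u (nqv K + n)) (xc K (nqv K + n)))
        = (\<Sum>n<nqf K. scaled_normal K n j * \<zeta> j (qtilde S \<beta> K u (nqv K + n)) (xf K n))"
      by (subst sum.swap) (auto simp: sum_Gf_Bf(1)[OF K] xc_def simp flip: sum_distrib_right intro!: sum.cong)
  qed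
  also have "\<dots> = (\<Sum>n<nqf K. \<Sum>j\<in>UNIV. scaled_normal K n j * \<zeta> j (qtilde S \<beta> K u (nqv K + n)) (xf K n))"
    by (rule sum.swap)
  finally show ?thesis unfolding N_def .
qed

lemma node_value_expansion: "node_value v n = (\<Sum>\<alpha>\<in>UNIV. (v \<alpha> $ n) *\<^sub>R axis \<alpha> 1)"
  by (subst basis_expansion[symmetric]) (simp add: node_value_def scalar_mult_eq_scaleR)

lemma nodes_in_domain:
  assumes mesh: "periodic_mesh T X L nbr" and K: "K \<in> T"
  shows "n < nqv K \<Longrightarrow> xv K n \<in> X" "n < nqf K \<Longrightarrow> xf K n \<in> X"
    "n < nqv K + nqf K \<Longrightarrow> xc K n \<in> X"
proof -
  have V: "valid_element K" and sub: "phys_elem K \<subseteq> X"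
    using mesh K unfolding periodic_mesh_def by auto
  have nv: "\<forall>n<nqv K. node_v K n \<in> ref_elem K"
    and nf: "\<forall>n<nqf K. outward_unit_normal (phys_elem K) (xf K n) (out_normal K n)"
    using V by (simp_all add: valid_element_def)
  show v: "xv K n \<in> X" if "n < nqv K" for n
    using nv sub that unfolding xv_def phys_elem_def by blast
  show f: "xf K n \<in> X" if "n < nqf K" for n
    using nf sub that unfolding outward_unit_normal_def by blast
  show "xc K n \<in> X" if "n < nqv K + nqf K" for n
    using v f[of "n - nqv K"] that by (auto simp: xc_def)
qed

text \<open>Outside \<open>I\<close> the coefficient vectors may have any dimension, so \<open>qv\<close> is expanded into a sum over the
  basis functions for times in \<open>I\<close> only.\<close>

lemma entropy_chain_rule:
  fixes u :: "real \<Rightarrow> 'd::finite dg_element \<Rightarrow> 'c::finite \<Rightarrow> real vec"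
  assumes law: "entropy_balance_law S X A h g \<eta> \<zeta> \<beta> EP"
    and x: "xv K n \<in> X" and n: "n < nqv K" and t: "t \<in> I"
    and car: "\<And>s \<alpha>. s \<in> I \<Longrightarrow> u s K \<alpha> \<in> carrier_vec (np K)"
    and diff: "\<And>\<alpha> m. m < np K \<Longrightarrow> (\<lambda>s. u s K \<alpha> $ m) differentiable (at t within I)"
    and S: "qv K (u t K) n \<in> S"
  shows "((\<lambda>s. \<eta> (qv K (u s K) n) (xv K n)) has_vector_derivative
     inner (\<beta> (qv K (u t K) n) (xv K n)) (node_value (\<lambda>\<alpha>. Vv K *\<^sub>v
       vec (np K) (\<lambda>m. vector_derivative (\<lambda>s. u s K \<alpha> $ m) (at t within I))) n)) (at t within I)"
proof -
  define du where "du \<alpha> = vec (np K) (\<lambda>m. vector_derivative (\<lambda>s. u s K \<alpha> $ m) (at t within I))" for \<alpha>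
  have d: "((\<lambda>s. u s K \<alpha> $ m) has_vector_derivative du \<alpha> $ m) (at t within I)" if "m < np K" for \<alpha> m
    using diff[OF that] that by (simp add: du_def vector_derivative_works[symmetric])
  have "((\<lambda>s. (\<Sum>\<alpha>\<in>UNIV. (\<Sum>m<np K. Vv K $$ (n, m) * u s K \<alpha> $ m) *\<^sub>R axis \<alpha> 1) :: real^'c)
      has_vector_derivative (\<Sum>\<alpha>\<in>UNIV. (\<Sum>m<np K. Vv K $$ (n, m) * du \<alpha> $ m) *\<^sub>R axis \<alpha> 1)) (at t within I)"
    by (intro has_vector_derivative_sum bounded_linear.has_vector_derivative[OF bounded_linear_scaleR_left]
        has_vector_derivative_mult_right d) auto
  also have "(\<Sum>\<alpha>\<in>UNIV. (\<Sum>m<np K. Vv K $$ (n, m) * du \<alpha> $ m) *\<^sub>R axis \<alpha> 1)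
      = node_value (\<lambda>\<alpha>. Vv K *\<^sub>v du \<alpha>) n"
    unfolding node_value_expansion
    by (intro sum.cong refl, subst mult_mat_vec_sum[OF discretization_carriers(1) _ n]) (auto simp: du_def)
  finally have q: "((\<lambda>s. qv K (u s K) n) has_vector_derivative node_value (\<lambda>\<alpha>. Vv K *\<^sub>v du \<alpha>) n) (at t within I)"
  proof (rule has_vector_derivative_transform[OF t, rotated])
    fix s assume "s \<in> I"
    then show "qv K (u s K) n = (\<Sum>\<alpha>\<in>UNIV. (\<Sum>m<np K. Vv K $$ (n, m) * u s K \<alpha> $ m) *\<^sub>R axis \<alpha> 1)"
      unfolding qv_def node_value_expansion
      by (intro sum.cong refl, subst mult_mat_vec_sum[OF discretization_carriers(1) car n]) auto
  qed
  have "GDERIV (\<lambda>q. \<eta> q (xv K n)) (qv K (u t K) n) :> \<beta> (qv K (u t K) n) (xv K n)"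
    using law x S unfolding entropy_balance_law_def by blast
  then have "((\<lambda>q. \<eta> q (xv K n)) has_derivative (\<lambda>v. inner v (\<beta> (qv K (u t K) n) (xv K n))))
      (at (qv K (u t K) n))" by (simp add: gderiv_def)
  from has_derivative_compose[OF q[unfolded has_vector_derivative_def] this]
  show ?thesis unfolding has_vector_derivative_def du_def by (simp add: inner_commute)
qed

text \<open>The surface flux at the surface node \<open>n\<close> of \<open>K\<close>, with the state on \<open>K\<close> as its first argument.\<close>

definition surface_flux ::
  "(real^'c) set \<Rightarrow> (real^'c \<Rightarrow> real^'d \<Rightarrow> real^'c) \<Rightarrow>
   ('d \<Rightarrow> real^'d \<Rightarrow> real^'c \<Rightarrow> real^'d \<Rightarrow> real^'c \<Rightarrow> real^'d \<Rightarrow> real^'c) \<Rightarrow>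
   ('d dg_element \<times> nat \<Rightarrow> 'd dg_element \<times> nat) \<Rightarrow>
   ('d dg_element \<Rightarrow> 'c \<Rightarrow> real vec) \<Rightarrow> ('d::finite) dg_element \<Rightarrow> nat \<Rightarrow> 'd \<Rightarrow> real^'c::finite" where
  "surface_flux S \<beta> Ds nbr v K n j = (case nbr (K, n) of (K', n') \<Rightarrow>
     Ds j (out_normal K n) (qtilde_f S \<beta> K (v K) n) (xf K n) (qtilde_f S \<beta> K' (v K') n') (xf K' n'))"

text \<open>The numerical entropy flux out of \<open>K\<close> through the surface node \<open>n\<close>, including the scaled normal:
  the entropy flux of the interior state plus the contraction of the surface flux with the entropy
  variables.\<close>

definition entropy_outflow ::
  "(real^'c) set \<Rightarrow> (real^'c \<Rightarrow> real^'d \<Rightarrow> real^'c) \<Rightarrow> ('d \<Rightarrow> real^'c \<Rightarrow> real^'d \<Rightarrow> real) \<Rightarrow>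
   ('d \<Rightarrow> real^'d \<Rightarrow> real^'c \<Rightarrow> real^'d \<Rightarrow> real^'c \<Rightarrow> real^'d \<Rightarrow> real^'c) \<Rightarrow>
   ('d dg_element \<times> nat \<Rightarrow> 'd dg_element \<times> nat) \<Rightarrow>
   ('d dg_element \<Rightarrow> 'c \<Rightarrow> real vec) \<Rightarrow> ('d::finite) dg_element \<times> nat \<Rightarrow> real" where
  "entropy_outflow S \<beta> \<zeta> Ds nbr v = (\<lambda>(K, n). \<Sum>j\<in>UNIV. scaled_normal K n j *
     (inner (beta_f \<beta> K (v K :: 'c::finite \<Rightarrow> real vec) n) (surface_flux S \<beta> Ds nbr v K n j)
      + \<zeta> j (qtilde_f S \<beta> K (v K) n) (xf K n)))"

text \<open>The projected entropy variables \<open>beta_c\<close> have preimages in \<open>S\<close> at all nodes, so that \<open>qtilde\<close> is a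
  genuine inverse image and not an arbitrary value of \<open>inv_into\<close>.\<close>

definition admissible ::
  "(real^'c) set \<Rightarrow> (real^'c \<Rightarrow> real^'d \<Rightarrow> real^'c) \<Rightarrow> ('d::finite) dg_element \<Rightarrow>
   ('c::finite \<Rightarrow> real vec) \<Rightarrow> bool" where
  "admissible S \<beta> K v \<longleftrightarrow>
     (\<forall>n<nqv K + nqf K. beta_c \<beta> K v n \<in> (\<lambda>q. \<beta> q (xc K n)) ` S)"

lemma qtilde_admissible:
  assumes "admissible S \<beta> K v" "n < nqv K + nqf K"
  shows "qtilde S \<beta> K v n \<in> S" "\<beta> (qtilde S \<beta> K v n) (xc K n) = beta_c \<beta> K v n"
proof -
  have b: "beta_c \<beta> K v n \<in> (\<lambda>q. \<beta> q (xc K n)) ` S" using assms by (simp add: admissible_def)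
  show "qtilde S \<beta> K v n \<in> S" unfolding qtilde_def beta_inv_def by (rule inv_into_into[OF b])
  show "\<beta> (qtilde S \<beta> K v n) (xc K n) = beta_c \<beta> K v n"
    unfolding qtilde_def beta_inv_def using f_inv_into_f[OF b] by simp
qed

lemma qtilde_v_eq: "valid_element K \<Longrightarrow> n < nqv K \<Longrightarrow> qtilde_v S \<beta> K v n = qtilde S \<beta> K v n"
  by (simp add: qtilde_def qtilde_v_def beta_c_volume xc_def)

lemma qtilde_f_eq: "valid_element K \<Longrightarrow> n < nqf K \<Longrightarrow> qtilde_f S \<beta> K v n = qtilde S \<beta> K v (nqv K + n)"
  by (simp add: qtilde_def qtilde_f_def beta_c_surface xc_def)

lemma qtilde_v_admissible:
  assumes "valid_element K" "admissible S \<beta> K v" "n < nqv K"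
  shows "qtilde_v S \<beta> K v n \<in> S" "\<beta> (qtilde_v S \<beta> K v n) (xv K n) = beta_v \<beta> K v n"
  using qtilde_admissible[OF assms(2), of n] assms by (simp_all add: qtilde_v_eq beta_c_volume xc_def)

lemma qtilde_f_admissible:
  assumes "valid_element K" "admissible S \<beta> K v" "n < nqf K"
  shows "qtilde_f S \<beta> K v n \<in> S" "\<beta> (qtilde_f S \<beta> K v n) (xf K n) = beta_f \<beta> K v n"
  using qtilde_admissible[OF assms(2), of "nqv K + n"] assms
  by (simp_all add: qtilde_f_eq beta_c_surface xc_def)

text \<open>The scheme is tested with the coefficients \<open>betaN\<close> of the projected entropy variables.  Here \<open>du\<close>
  stands for the time derivative of the coefficients.\<close>

lemma element_entropy_balance:
  fixes du :: "'c::finite \<Rightarrow> real vec" and v :: "'d::finite dg_element \<Rightarrow> 'c \<Rightarrow> real vec"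
  assumes law: "entropy_balance_law S X A h g \<eta> \<zeta> \<beta> EP"
    and mesh: "periodic_mesh T X L nbr"
    and shuffle: "conservative_entropy_shuffle S X \<beta> \<zeta> D"
    and K: "K \<in> T" and adm: "admissible S \<beta> K (v K)"
    and du: "\<And>\<alpha>. du \<alpha> \<in> carrier_vec (np K)"
    and scheme: "\<And>\<alpha>. Mv K *\<^sub>v du \<alpha>
          + (Vc K)\<^sup>T *\<^sub>v sum_vec (nqv K + nqf K) (\<lambda>j. sum_vec (nqv K + nqf K) (\<lambda>k.
              (Gc K j k * (Qc K k \<circ>\<^sub>h vol_flux_mat S \<beta> D K (v K) j \<alpha>)
               - (vol_flux_mat S \<beta> D K (v K) j \<alpha> \<circ>\<^sub>h (Qc K k)\<^sup>T) * Gc K j k)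
              *\<^sub>v ones (nqv K + nqf K)))
          = (Vv K)\<^sup>T * Jv K * Wv K *\<^sub>v source_vec S \<beta> g K (v K) \<alpha>
          - sum_vec (np K) (\<lambda>j. sum_vec (np K) (\<lambda>k.
              (Vf K)\<^sup>T * Gf K j k * Bf K k *\<^sub>v surf_flux_vec S \<beta> Ds nbr v K j \<alpha>))"
  shows "(\<Sum>n<nqv K. vol_jac K (node_v K n) * weight_v K n *
       inner (\<beta> (qv K (v K) n) (xv K n)) (node_value (\<lambda>\<alpha>. Vv K *\<^sub>v du \<alpha>) n))
    = (\<Sum>n<nqv K. vol_jac K (node_v K n) * weight_v K n * EP (qtilde_v S \<beta> K (v K) n) (xv K n))
      - (\<Sum>n<nqf K. entropy_outflow S \<beta> \<zeta> Ds nbr v (K, n))"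
    (is "?lhs = ?rhs")
proof -
  have V: "valid_element K" using mesh K unfolding periodic_mesh_def by blast
  define a b c d where abcd: "a \<alpha> = Mv K *\<^sub>v du \<alpha>"
    "b \<alpha> = (Vc K)\<^sup>T *\<^sub>v sum_vec (nqv K + nqf K) (\<lambda>j. sum_vec (nqv K + nqf K) (\<lambda>k.
              (Gc K j k * (Qc K k \<circ>\<^sub>h vol_flux_mat S \<beta> D K (v K) j \<alpha>)
               - (vol_flux_mat S \<beta> D K (v K) j \<alpha> \<circ>\<^sub>h (Qc K k)\<^sup>T) * Gc K j k)
              *\<^sub>v ones (nqv K + nqf K)))"
    "c \<alpha> = (Vv K)\<^sup>T * Jv K * Wv K *\<^sub>v source_vec S \<beta> g K (v K) \<alpha>"
    "d \<alpha> = sum_vec (np K) (\<lambda>j. sum_vec (np K) (\<lambda>k.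
              (Vf K)\<^sup>T * Gf K j k * Bf K k *\<^sub>v surf_flux_vec S \<beta> Ds nbr v K j \<alpha>))" for \<alpha>
  let ?b = "\<lambda>\<alpha>. betaN \<beta> K (v K) \<alpha>"
  have "?b \<alpha> \<bullet> a \<alpha> + ?b \<alpha> \<bullet> b \<alpha> = ?b \<alpha> \<bullet> c \<alpha> - ?b \<alpha> \<bullet> d \<alpha>" for \<alpha>
  proof -
    have b: "b \<alpha> \<in> carrier_vec (np K)"
      unfolding abcd by (rule mult_mat_vec_carrier[of _ "np K" "nqv K + nqf K"]) simp_all
    have car: "a \<alpha> \<in> carrier_vec (np K)" "c \<alpha> \<in> carrier_vec (np K)" "d \<alpha> \<in> carrier_vec (np K)"
      unfolding abcd using du
      by (auto intro!: mult_mat_vec_carrier mult_carrier_mat[of _ _ "nqv K"] simp: source_vec_def)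
    show ?thesis
      using scheme[of \<alpha>, folded abcd] scalar_prod_add_distrib[OF betaN_carrier[OF V] car(1) b]
        scalar_prod_minus_distrib[OF betaN_carrier[OF V] car(2,3)] by metis
  qed
  then have eq: "(\<Sum>\<alpha>\<in>UNIV. ?b \<alpha> \<bullet> a \<alpha>) + (\<Sum>\<alpha>\<in>UNIV. ?b \<alpha> \<bullet> b \<alpha>)
      = (\<Sum>\<alpha>\<in>UNIV. ?b \<alpha> \<bullet> c \<alpha>) - (\<Sum>\<alpha>\<in>UNIV. ?b \<alpha> \<bullet> d \<alpha>)"
    by (simp flip: sum.distrib sum_subtractf)
  have A: "(\<Sum>\<alpha>\<in>UNIV. ?b \<alpha> \<bullet> a \<alpha>) = ?lhs"
    unfolding abcd by (rule mass_term[OF V du])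
  have B: "(\<Sum>\<alpha>\<in>UNIV. ?b \<alpha> \<bullet> b \<alpha>) =
      (\<Sum>n<nqf K. \<Sum>j\<in>UNIV. scaled_normal K n j * \<zeta> j (qtilde_f S \<beta> K (v K) n) (xf K n))"
    unfolding abcd
    by (subst volume_term[OF V shuffle nodes_in_domain(3)[OF mesh K] qtilde_admissible[OF adm]])
      (auto simp: qtilde_f_eq[OF V])
  have C: "(\<Sum>\<alpha>\<in>UNIV. ?b \<alpha> \<bullet> c \<alpha>) =
      (\<Sum>n<nqv K. vol_jac K (node_v K n) * weight_v K n * EP (qtilde_v S \<beta> K (v K) n) (xv K n))"
    unfolding abcd source_term[OF V]
  proof (intro sum.cong refl)
    fix n assume "n \<in> {..<nqv K}"
    then have "n < nqv K" by simp
    note q = qtilde_v_admissible[OF V adm this] nodes_in_domain(1)[OF mesh K this]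
    have "EP (qtilde_v S \<beta> K (v K) n) (xv K n) = inner (beta_v \<beta> K (v K) n) (g (qtilde_v S \<beta> K (v K) n) (xv K n))"
      using law q unfolding entropy_balance_law_def by metis
    then show "vol_jac K (node_v K n) * weight_v K n *
         inner (beta_v \<beta> K (v K) n) (g (qtilde_v S \<beta> K (v K) n) (xv K n)) =
        vol_jac K (node_v K n) * weight_v K n * EP (qtilde_v S \<beta> K (v K) n) (xv K n)" by simp
  qed
  have D: "(\<Sum>\<alpha>\<in>UNIV. ?b \<alpha> \<bullet> d \<alpha>) =
      (\<Sum>n<nqf K. \<Sum>j\<in>UNIV. scaled_normal K n j * inner (beta_f \<beta> K (v K) n) (surface_flux S \<beta> Ds nbr v K n j))"
  proof -
    have "node_value (surf_flux_vec S \<beta> Ds nbr v K j) n = surface_flux S \<beta> Ds nbr v K n j" if "n < nqf K" for n j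
      using that by (simp add: node_value_def surf_flux_vec_def surface_flux_def Finite_Cartesian_Product.vec_eq_iff split: prod.split)
    then show ?thesis
      unfolding abcd by (subst surface_term[OF V]) (auto simp: surf_flux_vec_def)
  qed
  have "(\<Sum>n<nqf K. entropy_outflow S \<beta> \<zeta> Ds nbr v (K, n)) =
      (\<Sum>\<alpha>\<in>UNIV. ?b \<alpha> \<bullet> d \<alpha>) + (\<Sum>\<alpha>\<in>UNIV. ?b \<alpha> \<bullet> b \<alpha>)"
    unfolding B D by (simp add: entropy_outflow_def distrib_left sum.distrib)
  then show ?thesis using eq A C by simp
qed

section \<open>Entropy exchange across faces\<close>

text \<open>The matching condition only says that the scaled normals are opposite; that the unit normals
  themselves are opposite is needed because the surface flux may depend on them.\<close>

lemma periodic_mesh_nbr: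
  assumes mesh: "periodic_mesh T X L nbr" and l: "K \<in> T" "l < nqf K" and nbr: "nbr (K, l) = (K', l')"
  shows "K' \<in> T" "l' < nqf K'" "nbr (K', l') = (K, l)"
    "scaled_normal K' l' j = - scaled_normal K l j"
    "out_normal K' l' = - out_normal K l"
proof -
  have n: "(K, l) \<in> surface_nodes T" using l by (simp add: surface_nodes_def)
  have V: "valid_element K" using mesh l unfolding periodic_mesh_def by blast
  have *: "\<forall>(K, n)\<in>surface_nodes T. \<forall>K' n'. nbr (K, n) = (K', n') \<longrightarrow>
        (K', n') \<in> surface_nodes T \<and> nbr (K', n') = (K, n) \<and>
        (K', node_face K' n') \<noteq> (K, node_face K n) \<and>
        xf K' n' - xf K n \<in> L \<and>
        (\<forall>j. sum_mat (nqf K) (nqf K) (\<lambda>k. Gf K j k * Bf K k) $$ (n, n) =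
             - sum_mat (nqf K') (nqf K') (\<lambda>k. Gf K' j k * Bf K' k) $$ (n', n'))"
    using mesh unfolding periodic_mesh_def by (elim conjE)
  then have "(K', l') \<in> surface_nodes T" and ret: "nbr (K', l') = (K, l)"
    and s: "\<And>j. sum_mat (nqf K) (nqf K) (\<lambda>k. Gf K j k * Bf K k) $$ (l, l) =
             - sum_mat (nqf K') (nqf K') (\<lambda>k. Gf K' j k * Bf K' k) $$ (l', l')"
    using n nbr by auto
  then show K': "K' \<in> T" "l' < nqf K'" "nbr (K', l') = (K, l)" by (auto simp: surface_nodes_def)
  have V': "valid_element K'" using mesh K' unfolding periodic_mesh_def by blast
  have sn: "scaled_normal K' l' j = - scaled_normal K l j" for j
    using s[of j] sum_Gf_Bf(2)[OF V l(2)] sum_Gf_Bf(2)[OF V' K'(2)] by simp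
  then show "scaled_normal K' l' j = - scaled_normal K l j" .
  define r r' where "r = weight_f K l * face_jac K l" and "r' = weight_f K' l' * face_jac K' l'"
  have pos: "r > 0" "r' > 0" and unit: "norm (out_normal K l) = 1" "norm (out_normal K' l') = 1"
    using V V' l K' unfolding valid_element_def outward_unit_normal_def r_def r'_def by simp_all
  have eq: "r' *\<^sub>R out_normal K' l' = - (r *\<^sub>R out_normal K l)"
    using sn by (simp add: Finite_Cartesian_Product.vec_eq_iff r_def r'_def scaled_normal_def mult.assoc)
  \<comment> \<open>Both normals are unit vectors and both scalings are positive, hence the scalings agree.\<close>
  then have "norm (r' *\<^sub>R out_normal K' l') = norm (r *\<^sub>R out_normal K l)" by simp
  then have "r' = r" using pos unit by simp
  then have "r *\<^sub>R out_normal K' l' = r *\<^sub>R (- out_normal K l)" using eq by simp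
  then show "out_normal K' l' = - out_normal K l" using pos by (simp only: scaleR_cancel_left) simp
qed

text \<open>Across a face, the two entropy outflows do not cancel, but the dissipative shuffle relation makes
  their sum nonnegative.\<close>

lemma face_entropy_outflow:
  assumes mesh: "periodic_mesh T X L nbr"
    and dissipative: "dissipative_entropy_shuffle T nbr S \<beta> \<zeta> Ds"
    and adm: "\<And>K. K \<in> T \<Longrightarrow> admissible S \<beta> K (v K)"
    and l: "K \<in> T" "l < nqf K"
  shows "entropy_outflow S \<beta> \<zeta> Ds nbr v (K, l) + entropy_outflow S \<beta> \<zeta> Ds nbr v (nbr (K, l)) \<ge> 0"
proof -
  obtain K' l' where nbr: "nbr (K, l) = (K', l')" by (cases "nbr (K, l)")
  note N = periodic_mesh_nbr[OF mesh l nbr]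
  have V: "valid_element K" "valid_element K'" using mesh l N unfolding periodic_mesh_def by auto
  define q p x y n where "q = qtilde_f S \<beta> K (v K) l" and "p = qtilde_f S \<beta> K' (v K') l'"
    and "x = xf K l" and "y = xf K' l'" and "n = out_normal K l"
  have q: "q \<in> S" "\<beta> q x = beta_f \<beta> K (v K) l" and p: "p \<in> S" "\<beta> p y = beta_f \<beta> K' (v K') l'"
    unfolding q_def p_def x_def y_def
    using qtilde_f_admissible V adm l N by blast+
  have "(K, l) \<in> surface_nodes T" using l by (simp add: surface_nodes_def)
  then have D: "(\<Sum>i\<in>UNIV. n $h i * (inner (\<beta> p y) (Ds i (- n) p y q x) - inner (\<beta> q x) (Ds i n q x p y)))
         \<le> (\<Sum>i\<in>UNIV. n $h i * (\<zeta> i q x - \<zeta> i p y))"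
    using dissipative nbr p(1) q(1) unfolding dissipative_entropy_shuffle_def x_def y_def n_def Let_def
    by fast
  have "entropy_outflow S \<beta> \<zeta> Ds nbr v (K, l) + entropy_outflow S \<beta> \<zeta> Ds nbr v (K', l')
    = (\<Sum>j\<in>UNIV. scaled_normal K l j * (inner (\<beta> q x) (Ds j n q x p y) + \<zeta> j q x)
        - scaled_normal K l j * (inner (\<beta> p y) (Ds j (- n) p y q x) + \<zeta> j p y))"
    unfolding entropy_outflow_def prod.case surface_flux_def nbr N(3,4,5) q(2) p(2)
    by (simp add: sum_subtractf sum_negf q_def p_def x_def y_def n_def)
  also have "\<dots> = weight_f K l * face_jac K l * ((\<Sum>i\<in>UNIV. n $h i * (\<zeta> i q x - \<zeta> i p y))
      - (\<Sum>i\<in>UNIV. n $h i * (inner (\<beta> p y) (Ds i (- n) p y q x) - inner (\<beta> q x) (Ds i n q x p y))))"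
    unfolding scaled_normal_def n_def[symmetric] sum_subtractf[symmetric] sum_distrib_left
    by (intro sum.cong refl) (simp add: algebra_simps)
  also have "\<dots> \<ge> 0"
    using D V l unfolding valid_element_def by (intro mult_nonneg_nonneg) (auto intro: less_imp_le)
  finally show ?thesis unfolding nbr .
qed

lemma total_entropy_outflow:
  assumes mesh: "periodic_mesh T X L nbr"
    and dissipative: "dissipative_entropy_shuffle T nbr S \<beta> \<zeta> Ds"
    and adm: "\<And>K. K \<in> T \<Longrightarrow> admissible S \<beta> K (v K)"
  shows "(\<Sum>K\<in>T. \<Sum>n<nqf K. entropy_outflow S \<beta> \<zeta> Ds nbr v (K, n)) \<ge> 0"
proof -
  let ?F = "entropy_outflow S \<beta> \<zeta> Ds nbr v"
  have fin: "finite T" using mesh unfolding periodic_mesh_def by blast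
  have SN: "surface_nodes T = Sigma T (\<lambda>K. {..<nqf K})" by (auto simp: surface_nodes_def)
  have nbr: "nbr p \<in> surface_nodes T \<and> nbr (nbr p) = p" if "p \<in> surface_nodes T" for p
  proof -
    obtain K l K' l' where p: "p = (K, l)" "nbr (K, l) = (K', l')" by (metis surj_pair)
    then have "K \<in> T" "l < nqf K" using that by (auto simp: surface_nodes_def)
    from periodic_mesh_nbr(1-3)[OF mesh this p(2)] p show ?thesis by (simp add: surface_nodes_def)
  qed
  \<comment> \<open>\<open>nbr\<close> is an involution of the surface nodes, so each matched pair is counted twice.\<close>
  have "(\<Sum>p\<in>surface_nodes T. ?F (nbr p)) = (\<Sum>p\<in>surface_nodes T. ?F p)"
    by (rule sum.reindex_bij_witness[of _ nbr nbr]) (auto simp: nbr)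
  then have "2 * (\<Sum>p\<in>surface_nodes T. ?F p) = (\<Sum>p\<in>surface_nodes T. ?F p + ?F (nbr p))"
    by (simp add: sum.distrib)
  also have "\<dots> \<ge> 0"
    using face_entropy_outflow[OF mesh dissipative adm]
    by (intro sum_nonneg) (auto simp: surface_nodes_def)
  finally have "(\<Sum>p\<in>surface_nodes T. ?F p) \<ge> 0" by simp
  then show ?thesis using fin by (simp add: SN sum.Sigma)
qed

section \<open>Entropy stability\<close>

theorem theorem5:
  fixes T :: "('d::finite) dg_element set"
    and X L :: "(real^'d) set"
    and nbr :: "'d dg_element \<times> nat \<Rightarrow> 'd dg_element \<times> nat"
    and S :: "(real^'c::finite) set"
    and A :: "'d \<Rightarrow> real^'c \<Rightarrow> real^'d \<Rightarrow> real^'e::finite^'c"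
    and h :: "'d \<Rightarrow> real^'c \<Rightarrow> real^'d \<Rightarrow> real^'e"
    and g \<beta> :: "real^'c \<Rightarrow> real^'d \<Rightarrow> real^'c"
    and \<eta> EP :: "real^'c \<Rightarrow> real^'d \<Rightarrow> real"
    and \<zeta> :: "'d \<Rightarrow> real^'c \<Rightarrow> real^'d \<Rightarrow> real"
    and \<A> :: "'d \<Rightarrow> real^'c \<Rightarrow> real^'d \<Rightarrow> real^'c \<Rightarrow> real^'d \<Rightarrow> real^'e^'c"
    and \<H> :: "'d \<Rightarrow> real^'c \<Rightarrow> real^'d \<Rightarrow> real^'c \<Rightarrow> real^'d \<Rightarrow> real^'e"
    and Ds :: "'d \<Rightarrow> real^'d \<Rightarrow> real^'c \<Rightarrow> real^'d \<Rightarrow> real^'c \<Rightarrow> real^'d \<Rightarrow> real^'c"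
    and I :: "real set"
    and u :: "real \<Rightarrow> 'd dg_element \<Rightarrow> 'c \<Rightarrow> real vec"
    and t :: real
  assumes law: "entropy_balance_law S X A h g \<eta> \<zeta> \<beta> EP"
    and flux: "consistent_flux S X A h \<A> \<H>"
    and mesh: "periodic_mesh T X L nbr"
    and conservative: "conservative_entropy_shuffle S X \<beta> \<zeta> (volume_flux \<A> \<H> h)"
    and dissipative: "dissipative_entropy_shuffle T nbr S \<beta> \<zeta> Ds"
    and interval: "is_interval I" "interior I \<noteq> {}"
    and solution: "dg_solution T nbr S \<beta> g (volume_flux \<A> \<H> h) Ds I u"
    and t: "t \<in> I"
  shows "(\<forall>K\<in>T. \<forall>n<nqv K. (\<lambda>s. \<eta> (qv K (u s K) n) (xv K n)) differentiable (at t within I)) \<and>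
    (\<Sum>K\<in>T. ones (nqv K) \<bullet> (Jv K * Wv K *\<^sub>v
       vec (nqv K) (\<lambda>n. vector_derivative (\<lambda>s. \<eta> (qv K (u s K) n) (xv K n)) (at t within I))))
    \<le> (\<Sum>K\<in>T. ones (nqv K) \<bullet> (Jv K * Wv K *\<^sub>v
       vec (nqv K) (\<lambda>n. EP (qtilde_v S \<beta> K (u t K) n) (xv K n))))"
proof -
  define du where "du K \<alpha> = vec (np K) (\<lambda>m. vector_derivative (\<lambda>s. u s K \<alpha> $ m) (at t within I))" for K \<alpha>
  define d\<eta> where "d\<eta> K n = inner (\<beta> (qv K (u t K) n) (xv K n)) (node_value (\<lambda>\<alpha>. Vv K *\<^sub>v du K \<alpha>) n)" for K n
  \<comment> \<open>\<open>t\<close> is a limit point of \<open>I\<close>, so derivatives within \<open>I\<close> are unique at \<open>t\<close>.\<close>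
  have lim: "at t within I \<noteq> bot"
  proof -
    have "\<nexists>a. I = {a}" using interval(2) by (metis interior_singleton)
    then have "t islimpt I"
      using connected_imp_perfect[OF is_interval_connected[OF interval(1)] t] by blast
    then show ?thesis by (simp add: trivial_limit_within)
  qed
  have d: "((\<lambda>s. \<eta> (qv K (u s K) n) (xv K n)) has_vector_derivative d\<eta> K n) (at t within I)"
    if "K \<in> T" "n < nqv K" for K n
    unfolding d\<eta>_def du_def
    using solution t that nodes_in_domain(1)[OF mesh that]
    by (intro entropy_chain_rule[OF law]) (auto simp: dg_solution_def)
  have adm: "admissible S \<beta> K (u t K)" if "K \<in> T" for K
    using solution t that by (simp add: dg_solution_def admissible_def)
  have bal: "(\<Sum>n<nqv K. vol_jac K (node_v K n) * weight_v K n * d\<eta> K n)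
    = (\<Sum>n<nqv K. vol_jac K (node_v K n) * weight_v K n * EP (qtilde_v S \<beta> K (u t K) n) (xv K n))
      - (\<Sum>n<nqf K. entropy_outflow S \<beta> \<zeta> Ds nbr (u t) (K, n))" if K: "K \<in> T" for K
    unfolding d\<eta>_def
    by (rule element_entropy_balance[where v = "u t", OF law mesh conservative K adm[OF K]])
      (use solution t K in \<open>simp_all add: dg_solution_def du_def\<close>)
  have "vector_derivative (\<lambda>s. \<eta> (qv K (u s K) n) (xv K n)) (at t within I) = d\<eta> K n"
    if "K \<in> T" "n < nqv K" for K n
    using vector_derivative_within[OF lim d[OF that]] .
  then have "(\<Sum>K\<in>T. ones (nqv K) \<bullet> (Jv K * Wv K *\<^sub>v
       vec (nqv K) (\<lambda>n. vector_derivative (\<lambda>s. \<eta> (qv K (u s K) n) (xv K n)) (at t within I))))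
     = (\<Sum>K\<in>T. \<Sum>n<nqv K. vol_jac K (node_v K n) * weight_v K n * d\<eta> K n)"
    by (simp add: volume_quadrature)
  also have "\<dots> \<le> (\<Sum>K\<in>T. \<Sum>n<nqv K. vol_jac K (node_v K n) * weight_v K n *
      EP (qtilde_v S \<beta> K (u t K) n) (xv K n))"
    using total_entropy_outflow[OF mesh dissipative adm] by (simp add: bal sum_subtractf)
  finally show ?thesis
    using d by (auto simp: volume_quadrature intro: differentiableI_vector)
qed

end
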